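(* Let $G$ be a compact Vilenkin group. Then the spectral dimension of $G$, i.e. $\mathcal{S}dim(C(G),G,\Delta)$, is equal to $0$.
   Context: A topological group $G$ is a compact Vilenkin group if it possesses a strictly decreasing sequence $G=G_0\supset G_1\supset G_2\supset\cdots$ of compact open normal subgroups of $G$ such that (i) $2\le |G_n/G_{n+1}|<\infty$ for all $n\in\mathbb{N}_0$; (ii) $(G_n)_{n\in\mathbb{N}_0}$ is a basis of neighbourhoods at the identity $e$ and $\bigcap_{n}G_n=\{e\}$. Spectral dimension: for a compact group $G$, let $\Delta:C(G)\to C(G)\otimes C(G)=C(G\times G)$, $\Delta(f)(x,y)=f(xy)$; $(C(G),G,\Delta)$ is the canonical ergodic $C^*$-dynamical system, whose invariant state is given by the Haar measure. Let $\mathcal{O}(G)\subseteq C(G)$ be the dense $*$-subalgebra generated by matrix entries of irreducible unitary representations, and $\mathcal{A}=\{f\in C(G):\Delta(f)\in C(G)\otimes_{alg}\mathcal{O}(G)\}$. Let $\pi$ be the representation of $C(G)$ on $L^2(G)$ (Haar measure) by multiplication, and $R$ the right regular representation $(R_xf)(y)=f(yx)$; $(\pi,R)$ is the covariant representation associated with the invariant state. Let $\mathcal{E}$ be the class of spectral triples $(L^2(G),\pi,D)$ for $\mathcal{A}$ (that is, $D$ is a self-adjoint operator with compact resolvent on $L^2(G)$ and $[D,\pi(f)]$ extends to a bounded operator for every $f\in\mathcal{A}$) that are equivariant, i.e. $D$ commutes with $R_x$ for all $x\in G$. $D$ is $s$-summable if $\mathrm{Tr}\,|D|^{-s}<\infty$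 (with $|D|^{-s}$ taken to be $0$ on $\ker D$). Then $$\mathcal{S}dim(C(G),G,\Delta)=\inf\{s>0:\exists\, D \text{ such that } (L^2(G),\pi,D)\in\mathcal{E}\text{ and } D \text{ is } s\text{-summable}\}.$$ *)

theory Defs
  imports
    "HOL-Probability.Probability_Measure"
    "HOL-Algebra.Coset"
    "Jordan_Normal_Form.Schur_Decomposition"
    "Jordan_Normal_Form.VS_Connect"
begin

section \<open>Compact Vilenkin groups\<close>

definition topological_group :: "('a, 'b) monoid_scheme \<Rightarrow> 'a topology \<Rightarrow> bool" where
  "topological_group G T \<longleftrightarrow>
     group G \<and> topspace T = carrier G \<and>
     continuous_map (prod_topology T T) T (\<lambda>(x, y). x \<otimes>\<^bsub>G\<^esub> y) \<and>
     continuous_map T T (\<lambda>x. inv\<^bsub>G\<^esub> x)"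

definition vilenkin_sequence ::
    "('a, 'b) monoid_scheme \<Rightarrow> 'a topology \<Rightarrow> (nat \<Rightarrow> 'a set) \<Rightarrow> bool" where
  "vilenkin_sequence G T H \<longleftrightarrow>
     H 0 = carrier G \<and>
     (\<forall>n. H (Suc n) \<subset> H n) \<and>
     (\<forall>n. compactin T (H n) \<and> openin T (H n) \<and> H n \<lhd> G) \<and>
     (\<forall>n. finite (carrier (G\<lparr>carrier := H n\<rparr> Mod H (Suc n))) \<and>
          2 \<le> card (carrier (G\<lparr>carrier := H n\<rparr> Mod H (Suc n)))) \<and>
     (\<forall>U. openin T U \<and> \<one>\<^bsub>G\<^esub> \<in> U \<longrightarrow> (\<exists>n. H n \<subseteq> U)) \<and>
     (\<Inter>n. H n) = {\<one>\<^bsub>G\<^esub>}"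

definition compact_vilenkin_group :: "('a, 'b) monoid_scheme \<Rightarrow> 'a topology \<Rightarrow> bool" where
  "compact_vilenkin_group G T \<longleftrightarrow>
     topological_group G T \<and> (\<exists>H. vilenkin_sequence G T H)"


section \<open>Normalised Haar measure\<close>

text \<open>Regularity is not required: compact Vilenkin groups are compact and metrisable, so every
  Borel probability measure on them is regular. On such a group there is exactly one measure
  as below, and it is also right invariant.\<close>

definition haar_probability ::
    "('a, 'b) monoid_scheme \<Rightarrow> 'a topology \<Rightarrow> 'a measure \<Rightarrow> bool" where
  "haar_probability G T M \<longleftrightarrow>
     space M = carrier G \<and>
     sets M = sigma_sets (topspace T) {U. openin T U} \<and>
     prob_space M \<and>
     (\<forall>x\<in>carrier G. \<forall>A\<in>sets M. emeasure M (x <#\<^bsub>G\<^esub> A) = emeasure M A)"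


section \<open>The algebras \<open>\<O>(G)\<close> and \<open>\<A>\<close>\<close>

text \<open>Functions on \<open>G\<close> are total functions on the underlying type of which only the values on
  \<open>carrier G\<close> matter. Irreducible unitary representations of a compact group are finite
  dimensional; they are given here by their matrices with respect to an orthonormal basis.\<close>

definition unitary_rep ::
    "('a, 'b) monoid_scheme \<Rightarrow> 'a topology \<Rightarrow> nat \<Rightarrow> ('a \<Rightarrow> complex mat) \<Rightarrow> bool" where
  "unitary_rep G T n U \<longleftrightarrow>
     (\<forall>x\<in>carrier G. U x \<in> carrier_mat n n \<and> mat_adjoint (U x) * U x = 1\<^sub>m n) \<and>
     (\<forall>x\<in>carrier G. \<forall>y\<in>carrier G. U (x \<otimes>\<^bsub>G\<^esub> y) = U x * U y) \<and>
     (\<forall>i<n. \<forall>j<n. continuous_map T euclidean (\<lambda>x. U x $$ (i, j)))"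

definition irreducible_unitary_rep ::
    "('a, 'b) monoid_scheme \<Rightarrow> 'a topology \<Rightarrow> nat \<Rightarrow> ('a \<Rightarrow> complex mat) \<Rightarrow> bool" where
  "irreducible_unitary_rep G T n U \<longleftrightarrow>
     unitary_rep G T n U \<and> 0 < n \<and>
     (\<forall>W. VectorSpace.subspace class_ring W (module_vec TYPE(complex) n) \<and>
          (\<forall>x\<in>carrier G. \<forall>w\<in>W. U x *\<^sub>v w \<in> W) \<longrightarrow>
          W = {0\<^sub>v n} \<or> W = carrier_vec n)"

inductive_set coefficient_algebra ::
    "('a, 'b) monoid_scheme \<Rightarrow> 'a topology \<Rightarrow> ('a \<Rightarrow> complex) set"
  for G :: "('a, 'b) monoid_scheme" and T :: "'a topology" where
  entry: "irreducible_unitary_rep G T n U \<Longrightarrow> i < n \<Longrightarrow> j < n \<Longrightarrow>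
            (\<lambda>x. U x $$ (i, j)) \<in> coefficient_algebra G T"
| add: "f \<in> coefficient_algebra G T \<Longrightarrow> g \<in> coefficient_algebra G T \<Longrightarrow>
            (\<lambda>x. f x + g x) \<in> coefficient_algebra G T"
| scale: "f \<in> coefficient_algebra G T \<Longrightarrow> (\<lambda>x. c * f x) \<in> coefficient_algebra G T"
| mult: "f \<in> coefficient_algebra G T \<Longrightarrow> g \<in> coefficient_algebra G T \<Longrightarrow>
            (\<lambda>x. f x * g x) \<in> coefficient_algebra G T"
| star: "f \<in> coefficient_algebra G T \<Longrightarrow> (\<lambda>x. cnj (f x)) \<in> coefficient_algebra G T"

text \<open>Under \<open>C(G) \<otimes> C(G) = C(G \<times> G)\<close> the algebraic tensor product consists of the finite sums
  of functions \<open>(x, y) \<mapsto> g x * h y\<close>.\<close>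

definition smooth_algebra ::
    "('a, 'b) monoid_scheme \<Rightarrow> 'a topology \<Rightarrow> ('a \<Rightarrow> complex) set" where
  "smooth_algebra G T =
     {f. continuous_map T euclidean f \<and>
         (\<exists>(n::nat) g h.
            (\<forall>i<n. continuous_map T euclidean (g i) \<and> h i \<in> coefficient_algebra G T) \<and>
            (\<forall>x\<in>carrier G. \<forall>y\<in>carrier G. f (x \<otimes>\<^bsub>G\<^esub> y) = (\<Sum>i<n. g i x * h i y)))}"


section \<open>The Hilbert space \<open>L\<^sup>2\<close> and its operators\<close>

text \<open>Vectors are represented by square-integrable functions; functions that agree almost
  everywhere represent the same vector. Accordingly the domain of an operator is saturated under
  almost everywhere equality, operators respect it, and all equations between vectors are
  almost everywhere equations.\<close>

definition L2 :: "'a measure \<Rightarrow> ('a \<Rightarrow> complex) set" where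
  "L2 M = {f \<in> borel_measurable M. integrable M (\<lambda>x. (cmod (f x))\<^sup>2)}"

definition L2_inner :: "'a measure \<Rightarrow> ('a \<Rightarrow> complex) \<Rightarrow> ('a \<Rightarrow> complex) \<Rightarrow> complex" where
  "L2_inner M f g = (LINT x|M. f x * cnj (g x))"

definition L2_norm :: "'a measure \<Rightarrow> ('a \<Rightarrow> complex) \<Rightarrow> real" where
  "L2_norm M f = sqrt (LINT x|M. (cmod (f x))\<^sup>2)"

definition ae_eq :: "'a measure \<Rightarrow> ('a \<Rightarrow> complex) \<Rightarrow> ('a \<Rightarrow> complex) \<Rightarrow> bool" where
  "ae_eq M f g \<longleftrightarrow> (AE x in M. f x = g x)"

record 'a operator =
  op_dom :: "('a \<Rightarrow> complex) set"
  op_app :: "('a \<Rightarrow> complex) \<Rightarrow> ('a \<Rightarrow> complex)"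

definition linear_operator :: "'a measure \<Rightarrow> 'a operator \<Rightarrow> bool" where
  "linear_operator M D \<longleftrightarrow>
     op_dom D \<subseteq> L2 M \<and> (\<lambda>x. 0) \<in> op_dom D \<and>
     (\<forall>f\<in>op_dom D. op_app D f \<in> L2 M) \<and>
     (\<forall>f\<in>op_dom D. \<forall>g\<in>L2 M. ae_eq M f g \<longrightarrow>
        g \<in> op_dom D \<and> ae_eq M (op_app D f) (op_app D g)) \<and>
     (\<forall>f\<in>op_dom D. \<forall>g\<in>op_dom D. (\<lambda>x. f x + g x) \<in> op_dom D \<and>
        ae_eq M (op_app D (\<lambda>x. f x + g x)) (\<lambda>x. op_app D f x + op_app D g x)) \<and>
     (\<forall>c. \<forall>f\<in>op_dom D. (\<lambda>x. c * f x) \<in> op_dom D \<and>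
        ae_eq M (op_app D (\<lambda>x. c * f x)) (\<lambda>x. c * op_app D f x))"

definition bounded_operator :: "'a measure \<Rightarrow> 'a operator \<Rightarrow> bool" where
  "bounded_operator M B \<longleftrightarrow>
     linear_operator M B \<and> op_dom B = L2 M \<and>
     (\<exists>C. \<forall>f\<in>L2 M. L2_norm M (op_app B f) \<le> C * L2_norm M f)"

definition compact_operator :: "'a measure \<Rightarrow> 'a operator \<Rightarrow> bool" where
  "compact_operator M B \<longleftrightarrow>
     bounded_operator M B \<and>
     (\<forall>f :: nat \<Rightarrow> 'a \<Rightarrow> complex.
        (\<forall>k. f k \<in> L2 M) \<and> (\<exists>C. \<forall>k. L2_norm M (f k) \<le> C) \<longrightarrow>
        (\<exists>r g. strict_mono r \<and> g \<in> L2 M \<and>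
           (\<lambda>k. L2_norm M (\<lambda>x. op_app B (f (r k)) x - g x)) \<longlonglongrightarrow> 0))"

definition densely_defined :: "'a measure \<Rightarrow> 'a operator \<Rightarrow> bool" where
  "densely_defined M D \<longleftrightarrow>
     (\<forall>f\<in>L2 M. \<forall>\<epsilon>>0. \<exists>g\<in>op_dom D. L2_norm M (\<lambda>x. f x - g x) < \<epsilon>)"

text \<open>The right-hand side of the equivalence says that \<open>g\<close> lies in the domain of the adjoint
  \<open>D\<^sup>*\<close> and \<open>D\<^sup>* g = h\<close>; so the graphs of \<open>D\<close> and \<open>D\<^sup>*\<close> coincide.\<close>

definition self_adjoint :: "'a measure \<Rightarrow> 'a operator \<Rightarrow> bool" where
  "self_adjoint M D \<longleftrightarrow>
     linear_operator M D \<and> densely_defined M D \<and>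
     (\<forall>g\<in>L2 M. \<forall>h\<in>L2 M.
        (g \<in> op_dom D \<and> ae_eq M (op_app D g) h) \<longleftrightarrow>
        (\<forall>f\<in>op_dom D. L2_inner M (op_app D f) g = L2_inner M f h))"

text \<open>\<open>R = (D - z)\<^sup>-\<^sup>1\<close> as an everywhere defined bounded operator.\<close>

definition is_resolvent :: "'a measure \<Rightarrow> 'a operator \<Rightarrow> complex \<Rightarrow> 'a operator \<Rightarrow> bool" where
  "is_resolvent M D z R \<longleftrightarrow>
     bounded_operator M R \<and>
     (\<forall>g\<in>L2 M. op_app R g \<in> op_dom D \<and>
        ae_eq M (\<lambda>x. op_app D (op_app R g) x - z * op_app R g x) g) \<and>
     (\<forall>f\<in>op_dom D. ae_eq M (op_app R (\<lambda>x. op_app D f x - z * f x)) f)"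

text \<open>By the resolvent identity, compactness at one point of the resolvent set implies
  compactness at all of them.\<close>

definition compact_resolvent :: "'a measure \<Rightarrow> 'a operator \<Rightarrow> bool" where
  "compact_resolvent M D \<longleftrightarrow> (\<exists>z R. is_resolvent M D z R \<and> compact_operator M R)"

text \<open>The operator \<open>|D|\<^sup>-\<^sup>s\<close>, taken to be \<open>0\<close> on the kernel of \<open>D\<close>, for a self-adjoint \<open>D\<close> with
  compact resolvent. The eigenvectors of such a \<open>D\<close> span a dense subspace and its nonzero
  eigenvalues are bounded away from \<open>0\<close>, so the functional calculus gives a bounded operator
  which is determined by its action on eigenvectors.\<close>

definition is_abs_neg_power :: "'a measure \<Rightarrow> 'a operator \<Rightarrow> real \<Rightarrow> 'a operator \<Rightarrow> bool" where
  "is_abs_neg_power M D s P \<longleftrightarrow>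
     bounded_operator M P \<and>
     (\<forall>t::real. \<forall>f\<in>op_dom D. ae_eq M (op_app D f) (\<lambda>x. complex_of_real t * f x) \<longrightarrow>
        ae_eq M (op_app P f)
          (\<lambda>x. complex_of_real (if t = 0 then 0 else \<bar>t\<bar> powr (- s)) * f x))"

definition orthonormal_basis :: "'a measure \<Rightarrow> ('a \<Rightarrow> complex) set \<Rightarrow> bool" where
  "orthonormal_basis M E \<longleftrightarrow>
     E \<subseteq> L2 M \<and>
     (\<forall>e\<in>E. \<forall>e'\<in>E. L2_inner M e e' = (if e = e' then 1 else 0)) \<and>
     (\<forall>f\<in>L2 M. (\<forall>e\<in>E. L2_inner M f e = 0) \<longrightarrow> ae_eq M f (\<lambda>x. 0))"

text \<open>Finiteness of the trace of a positive operator; it does not depend on the orthonormal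
  basis.\<close>

definition finite_trace :: "'a measure \<Rightarrow> 'a operator \<Rightarrow> bool" where
  "finite_trace M P \<longleftrightarrow>
     (\<exists>E. orthonormal_basis M E \<and> (\<lambda>e. L2_inner M (op_app P e) e) summable_on E)"

definition summable_operator :: "'a measure \<Rightarrow> 'a operator \<Rightarrow> real \<Rightarrow> bool" where
  "summable_operator M D s \<longleftrightarrow> (\<exists>P. is_abs_neg_power M D s P \<and> finite_trace M P)"


section \<open>Equivariant spectral triples and the spectral dimension\<close>

text \<open>\<open>[D, \<pi>(f)]\<close> extends to a bounded operator; as usual this includes that multiplication by
  \<open>f\<close> preserves the domain of \<open>D\<close>.\<close>

definition bounded_commutator :: "'a measure \<Rightarrow> 'a operator \<Rightarrow> ('a \<Rightarrow> complex) \<Rightarrow> bool" where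
  "bounded_commutator M D f \<longleftrightarrow>
     (\<forall>g\<in>op_dom D. (\<lambda>x. f x * g x) \<in> op_dom D) \<and>
     (\<exists>B. bounded_operator M B \<and>
        (\<forall>g\<in>op_dom D.
           ae_eq M (op_app B g) (\<lambda>x. op_app D (\<lambda>y. f y * g y) x - f x * op_app D g x)))"

definition right_regular ::
    "('a, 'b) monoid_scheme \<Rightarrow> 'a \<Rightarrow> ('a \<Rightarrow> complex) \<Rightarrow> ('a \<Rightarrow> complex)" where
  "right_regular G x f = (\<lambda>y. f (y \<otimes>\<^bsub>G\<^esub> x))"

definition equivariant_operator ::
    "('a, 'b) monoid_scheme \<Rightarrow> 'a measure \<Rightarrow> 'a operator \<Rightarrow> bool" where
  "equivariant_operator G M D \<longleftrightarrow>
     (\<forall>x\<in>carrier G. \<forall>f\<in>op_dom D.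
        right_regular G x f \<in> op_dom D \<and>
        ae_eq M (op_app D (right_regular G x f)) (right_regular G x (op_app D f)))"

definition equivariant_spectral_triple ::
    "('a, 'b) monoid_scheme \<Rightarrow> 'a topology \<Rightarrow> 'a measure \<Rightarrow> 'a operator \<Rightarrow> bool" where
  "equivariant_spectral_triple G T M D \<longleftrightarrow>
     self_adjoint M D \<and> compact_resolvent M D \<and>
     (\<forall>f\<in>smooth_algebra G T. bounded_commutator M D f) \<and>
     equivariant_operator G M D"

text \<open>The infimum is taken in the extended reals, so that it is \<open>\<infinity>\<close> when no such \<open>D\<close> exists.\<close>

definition spectral_dimension ::
    "('a, 'b) monoid_scheme \<Rightarrow> 'a topology \<Rightarrow> 'a measure \<Rightarrow> ereal" where
  "spectral_dimension G T M =
     Inf (ereal ` {s. 0 < s \<and>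
       (\<exists>D. equivariant_spectral_triple G T M D \<and> summable_operator M D s)})"

end

theory Submission
  imports Defs "HOL-Complex_Analysis.Great_Picard"
begin

text \<open>Let \<open>H\<^sub>k\<close> be the subgroups of a Vilenkin sequence and \<open>m\<^sub>k\<close> the Haar measure of \<open>H\<^sub>k\<close>.
  The martingale differences \<open>P\<^sub>k = E\<^sub>k - E\<^sub>k\<^sub>-\<^sub>1\<close> of the conditional expectations onto the
  functions constant on cosets of \<open>H\<^sub>k\<close> commute with right translations. Since unitary matrix
  groups have no small subgroups, every smooth function is constant on the cosets of some
  \<open>H\<^sub>n\<close>, and multiplication by it commutes with \<open>P\<^sub>k\<close> for \<open>k > n\<close>. Hence \<open>D = \<Sum> \<lambda>\<^sub>k P\<^sub>k\<close> has
  bounded commutators for every choice of the \<open>\<lambda>\<^sub>k\<close>, and \<open>\<lambda>\<^sub>k = m\<^sub>k\<^sup>-\<^sup>k\<close> grows so fast that \<open>D\<close>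
  is \<open>s\<close>-summable for all \<open>s > 0\<close>.

  By Abel summation \<open>\<Sum> \<rho>\<^sub>k P\<^sub>k\<close> is the operator \<open>u \<mapsto> \<Sum> (\<rho>\<^sub>k - \<rho>\<^sub>k\<^sub>+\<^sub>1) / m\<^sub>k \<cdot> \<integral>\<^bsub>x H\<^sub>k\<^esub> u\<close>, a
  uniformly convergent series when \<open>\<rho>\<close> decays fast. So \<open>D\<close> is obtained as the inverse of such
  an operator, and neither completeness of \<open>L\<^sup>2\<close> nor a spectral theorem is needed.\<close>


section \<open>Square-integrable functions\<close>

text \<open>Origin of the exponent: P_k has rank at most 1/m_k, so Tr |D|^-s is at most the sum of
  m_k^(k s - 1), and m_k <= 2^-k makes this converge for every s > 0. A fixed power of 1/m_k would
  only reach s above a positive threshold. Since the indices may grow arbitrarily fast, the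
  eigenvalues have to be expressed through m_k and not through k alone. The obstacle is that D is
  unbounded. Its inverse is an injective symmetric bounded operator given by an explicit series, so
  the domain, self-adjointness and the compact resolvent of D are read off from that series.
  Identities between vectors are not proved by expansion in eigenvectors: both sides are paired with
  vectors that belong to a single level. These are total, and pairing replaces an operator by its
  scalar on that level, so each identity becomes an equation between eigenvalues.\<close>

lemma measurable_cnj [measurable]: "cnj \<in> borel_measurable borel"
  by (intro borel_measurable_continuous_onI continuous_intros)

lemma L2_measurable: "f \<in> L2 M \<Longrightarrow> f \<in> borel_measurable M"
  and L2_integrable_sq: "f \<in> L2 M \<Longrightarrow> integrable M (\<lambda>x. (cmod (f x))\<^sup>2)"
  by (auto simp: L2_def)

lemma L2_zero: "(\<lambda>x. 0) \<in> L2 M"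
  by (auto simp: L2_def)

lemma cmod_add_sq_le: "(cmod (a + b))\<^sup>2 \<le> 2 * (cmod a)\<^sup>2 + 2 * (cmod b)\<^sup>2"
proof -
  have "(cmod (a + b))\<^sup>2 \<le> (cmod a + cmod b)\<^sup>2"
    by (intro power_mono norm_triangle_ineq) auto
  also have "\<dots> \<le> 2 * (cmod a)\<^sup>2 + 2 * (cmod b)\<^sup>2"
    using zero_le_power2[of "cmod a - cmod b"] by (simp add: power2_eq_square algebra_simps)
  finally show ?thesis .
qed

lemma L2_add:
  assumes "f \<in> L2 M" "g \<in> L2 M"
  shows "(\<lambda>x. f x + g x) \<in> L2 M"
proof -
  note [measurable] = L2_measurable[OF assms(1)] L2_measurable[OF assms(2)]
  have "integrable M (\<lambda>x. (cmod (f x + g x))\<^sup>2)"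
  proof (rule Bochner_Integration.integrable_bound)
    show "integrable M (\<lambda>x. 2 * (cmod (f x))\<^sup>2 + 2 * (cmod (g x))\<^sup>2)"
      using assms by (auto simp: L2_def)
  qed (auto simp: cmod_add_sq_le)
  then show ?thesis by (simp add: L2_def)
qed

lemma L2_mult_bounded:
  assumes "f \<in> L2 M" "h \<in> borel_measurable M" "\<And>x. x \<in> space M \<Longrightarrow> cmod (h x) \<le> C"
  shows "(\<lambda>x. h x * f x) \<in> L2 M"
proof -
  note [measurable] = L2_measurable[OF assms(1)] assms(2)
  have "integrable M (\<lambda>x. (cmod (h x * f x))\<^sup>2)"
  proof (rule Bochner_Integration.integrable_bound)
    show "integrable M (\<lambda>x. C\<^sup>2 * (cmod (f x))\<^sup>2)"
      using assms by (auto simp: L2_def)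
    have "(cmod (h x * f x))\<^sup>2 \<le> C\<^sup>2 * (cmod (f x))\<^sup>2" if "x \<in> space M" for x
      using assms(3)[OF that]
      by (simp add: norm_mult power_mult_distrib mult_right_mono power_mono)
    then show "AE x in M. norm ((cmod (h x * f x))\<^sup>2) \<le> norm (C\<^sup>2 * (cmod (f x))\<^sup>2)"
      by (intro AE_I2) simp
  qed auto
  then show ?thesis by (simp add: L2_def)
qed

lemma L2_scale: "f \<in> L2 M \<Longrightarrow> (\<lambda>x. c * f x) \<in> L2 M"
  by (rule L2_mult_bounded[where C="cmod c"]) auto

lemma L2_diff:
  assumes "f \<in> L2 M" "g \<in> L2 M"
  shows "(\<lambda>x. f x - g x) \<in> L2 M"
  using L2_add[OF assms(1) L2_scale[OF assms(2), of "-1"]] by simp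

lemma L2_sum:
  assumes "\<And>i. i \<in> I \<Longrightarrow> f i \<in> L2 M"
  shows "(\<lambda>x. \<Sum>i\<in>I. f i x) \<in> L2 M"
  using assms
proof (induction I rule: infinite_finite_induct)
  case (insert i I)
  then show ?case using L2_add[of "f i" M "\<lambda>x. \<Sum>i\<in>I. f i x"] by simp
qed (auto simp: L2_zero)

lemma L2_integrable_inner:
  assumes "f \<in> L2 M" "g \<in> L2 M"
  shows "integrable M (\<lambda>x. f x * cnj (g x))"
    and "integrable M (\<lambda>x. cmod (f x) * cmod (g x))"
proof -
  note [measurable] = L2_measurable[OF assms(1)] L2_measurable[OF assms(2)]
  have i: "integrable M (\<lambda>x. (cmod (f x))\<^sup>2 + (cmod (g x))\<^sup>2)"
    using assms by (auto simp: L2_def)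
  have le: "a * b \<le> a\<^sup>2 + b\<^sup>2" for a b :: real
  proof -
    have "0 \<le> (a - b)\<^sup>2 + a\<^sup>2 + b\<^sup>2" by simp
    then show ?thesis by (simp add: power2_eq_square algebra_simps)
  qed
  show "integrable M (\<lambda>x. f x * cnj (g x))"
    by (rule Bochner_Integration.integrable_bound[OF i]) (auto simp: norm_mult intro: le)
  show "integrable M (\<lambda>x. cmod (f x) * cmod (g x))"
    by (rule Bochner_Integration.integrable_bound[OF i]) (auto simp: norm_mult intro: le)
qed

lemma (in finite_measure) L2_bounded:
  assumes "h \<in> borel_measurable M" "\<And>x. x \<in> space M \<Longrightarrow> cmod (h x) \<le> C"
  shows "h \<in> L2 M"
  using L2_mult_bounded[of "\<lambda>x. 1" M h C] assms by (simp add: L2_def)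

lemma (in finite_measure) L2_indicator: "A \<in> sets M \<Longrightarrow> indicator A \<in> L2 M"
  by (rule L2_bounded[where C=1]) (auto simp: indicator_def)

lemma (in finite_measure) L2_integrable: "f \<in> L2 M \<Longrightarrow> integrable M f"
  using L2_integrable_inner(1)[of f M "\<lambda>x. 1"] L2_bounded[of "\<lambda>x. 1" 1] by simp

section \<open>Inner product and norm\<close>

lemma L2_inner_add_left:
  assumes "f \<in> L2 M" "g \<in> L2 M" "h \<in> L2 M"
  shows "L2_inner M (\<lambda>x. f x + g x) h = L2_inner M f h + L2_inner M g h"
  unfolding L2_inner_def
  using L2_integrable_inner(1)[of f M h] L2_integrable_inner(1)[of g M h] assms
  by (simp add: distrib_right)

lemma L2_inner_diff_left:
  assumes "f \<in> L2 M" "g \<in> L2 M" "h \<in> L2 M"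
  shows "L2_inner M (\<lambda>x. f x - g x) h = L2_inner M f h - L2_inner M g h"
  unfolding L2_inner_def
  using L2_integrable_inner(1)[of f M h] L2_integrable_inner(1)[of g M h] assms
  by (simp add: left_diff_distrib)

lemma L2_inner_scale_left: "L2_inner M (\<lambda>x. c * f x) h = c * L2_inner M f h"
  unfolding L2_inner_def by (simp add: mult.assoc)

lemma L2_inner_scale_right: "L2_inner M f (\<lambda>x. c * h x) = cnj c * L2_inner M f h"
  unfolding L2_inner_def by (simp add: mult.left_commute)

lemma L2_inner_commute: "L2_inner M f g = cnj (L2_inner M g f)"
  unfolding L2_inner_def by (subst Bochner_Integration.integral_cnj[symmetric]) (simp add: mult.commute)

lemma L2_inner_sum_left:
  assumes "\<And>i. i \<in> I \<Longrightarrow> f i \<in> L2 M" "h \<in> L2 M"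
  shows "L2_inner M (\<lambda>x. \<Sum>i\<in>I. f i x) h = (\<Sum>i\<in>I. L2_inner M (f i) h)"
  unfolding L2_inner_def sum_distrib_right
  by (rule Bochner_Integration.integral_sum) (use assms in \<open>auto intro: L2_integrable_inner\<close>)

lemma L2_inner_cong_AE:
  assumes "ae_eq M f f'" "ae_eq M g g'"
    and "f \<in> L2 M" "f' \<in> L2 M" "g \<in> L2 M" "g' \<in> L2 M"
  shows "L2_inner M f g = L2_inner M f' g'"
proof -
  note [measurable] = assms(3-6)[THEN L2_measurable]
  show ?thesis unfolding L2_inner_def
    by (rule integral_cong_AE) (use assms(1,2) in \<open>auto simp: ae_eq_def\<close>)
qed

lemma L2_norm_nonneg [simp]: "0 \<le> L2_norm M f"
  by (simp add: L2_norm_def)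

lemma L2_norm_sq: "(L2_norm M f)\<^sup>2 = (LINT x|M. (cmod (f x))\<^sup>2)"
  by (simp add: L2_norm_def)

lemma L2_norm_scale: "L2_norm M (\<lambda>x. c * f x) = cmod c * L2_norm M f"
  by (simp add: L2_norm_def norm_mult power_mult_distrib real_sqrt_mult)

lemma L2_norm_minus_commute: "L2_norm M (\<lambda>x. f x - g x) = L2_norm M (\<lambda>x. g x - f x)"
  by (simp add: L2_norm_def norm_minus_commute)

lemma L2_inner_self: "L2_inner M f f = complex_of_real ((L2_norm M f)\<^sup>2)"
  unfolding L2_norm_sq L2_inner_def integral_complex_of_real[symmetric]
  by (simp only: complex_norm_square)

lemma L2_norm_eq_0_iff:
  assumes "f \<in> L2 M"
  shows "L2_norm M f = 0 \<longleftrightarrow> ae_eq M f (\<lambda>x. 0)"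
  unfolding L2_norm_def ae_eq_def
  using integral_nonneg_eq_0_iff_AE[OF L2_integrable_sq[OF assms]] by simp

text \<open>Young's inequality with the weights B/A and A/B, where A and B are the two norms: its
  right-hand side integrates to exactly A * B. The weights divide by the norms, so a vanishing norm
  is treated apart; the integrand is then zero almost everywhere.\<close>

lemma L2_cauchy_schwarz_abs:
  assumes "f \<in> L2 M" "g \<in> L2 M"
  shows "(LINT x|M. cmod (f x) * cmod (g x)) \<le> L2_norm M f * L2_norm M g"
proof (cases "L2_norm M f = 0 \<or> L2_norm M g = 0")
  case True
  then have "AE x in M. cmod (f x) * cmod (g x) = 0"
    using L2_norm_eq_0_iff assms unfolding ae_eq_def by (elim disjE) (force elim: eventually_mono)+
  then have "(LINT x|M. cmod (f x) * cmod (g x)) = 0"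
    by (rule integral_eq_zero_AE)
  then show ?thesis by simp
next
  case False
  define A B where "A = L2_norm M f" and "B = L2_norm M g"
  have AB: "A > 0" "B > 0" using False by (auto simp: A_def B_def less_le)
  have "(LINT x|M. cmod (f x) * cmod (g x))
      \<le> (LINT x|M. (B / A) / 2 * (cmod (f x))\<^sup>2 + (A / B) / 2 * (cmod (g x))\<^sup>2)"
  proof (rule integral_mono)
    show "integrable M (\<lambda>x. cmod (f x) * cmod (g x))" using assms by (rule L2_integrable_inner)
    show "integrable M (\<lambda>x. (B / A) / 2 * (cmod (f x))\<^sup>2 + (A / B) / 2 * (cmod (g x))\<^sup>2)"
      using assms by (auto simp: L2_def)
    fix x
    have "0 \<le> (B * cmod (f x) - A * cmod (g x))\<^sup>2 / (2 * A * B)" using AB by simp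
    also have "\<dots> = (B / A) / 2 * (cmod (f x))\<^sup>2 + (A / B) / 2 * (cmod (g x))\<^sup>2 - cmod (f x) * cmod (g x)"
      using AB by (simp add: field_simps power2_eq_square)
    finally show "cmod (f x) * cmod (g x) \<le> (B / A) / 2 * (cmod (f x))\<^sup>2 + (A / B) / 2 * (cmod (g x))\<^sup>2"
      by simp
  qed
  also have "\<dots> = (B / A) / 2 * A\<^sup>2 + (A / B) / 2 * B\<^sup>2"
    unfolding A_def B_def L2_norm_sq using assms by (simp add: L2_def)
  also have "\<dots> = A * B" using AB by (simp add: field_simps power2_eq_square)
  finally show ?thesis by (simp add: A_def B_def)
qed

lemma L2_cauchy_schwarz:
  assumes "f \<in> L2 M" "g \<in> L2 M"
  shows "cmod (L2_inner M f g) \<le> L2_norm M f * L2_norm M g"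
proof -
  have "cmod (L2_inner M f g) \<le> (LINT x|M. cmod (f x * cnj (g x)))"
    unfolding L2_inner_def by (rule integral_norm_bound)
  then show ?thesis using L2_cauchy_schwarz_abs[OF assms] by (simp add: norm_mult)
qed

lemma L2_norm_triangle:
  assumes "f \<in> L2 M" "g \<in> L2 M"
  shows "L2_norm M (\<lambda>x. f x + g x) \<le> L2_norm M f + L2_norm M g"
proof (rule power2_le_imp_le)
  have i: "integrable M (\<lambda>x. (cmod (f x))\<^sup>2)" "integrable M (\<lambda>x. (cmod (g x))\<^sup>2)"
    "integrable M (\<lambda>x. cmod (f x) * cmod (g x))"
    using assms L2_integrable_inner(2)[OF assms] by (auto simp: L2_def)
  have "(L2_norm M (\<lambda>x. f x + g x))\<^sup>2
      \<le> (LINT x|M. (cmod (f x))\<^sup>2 + 2 * (cmod (f x) * cmod (g x)) + (cmod (g x))\<^sup>2)"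
    unfolding L2_norm_sq
  proof (rule integral_mono)
    show "integrable M (\<lambda>x. (cmod (f x + g x))\<^sup>2)" using L2_add[OF assms]
      by (simp add: L2_def)
    fix x
    have "(cmod (f x + g x))\<^sup>2 \<le> (cmod (f x) + cmod (g x))\<^sup>2"
      by (intro power_mono norm_triangle_ineq) auto
    then show "(cmod (f x + g x))\<^sup>2 \<le> (cmod (f x))\<^sup>2 + 2 * (cmod (f x) * cmod (g x)) + (cmod (g x))\<^sup>2"
      by (simp add: power2_eq_square algebra_simps)
  qed (use i in auto)
  also have "\<dots> = (L2_norm M f)\<^sup>2 + 2 * (LINT x|M. cmod (f x) * cmod (g x)) + (L2_norm M g)\<^sup>2"
    unfolding L2_norm_sq using i by simp
  also have "\<dots> \<le> (L2_norm M f + L2_norm M g)\<^sup>2"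
    using L2_cauchy_schwarz_abs[OF assms] by (simp add: power2_eq_square algebra_simps)
  finally show "(L2_norm M (\<lambda>x. f x + g x))\<^sup>2 \<le> (L2_norm M f + L2_norm M g)\<^sup>2" .
qed simp

lemma L2_norm_triangle_diff:
  assumes "f \<in> L2 M" "g \<in> L2 M" "h \<in> L2 M"
  shows "L2_norm M (\<lambda>x. f x - h x) \<le> L2_norm M (\<lambda>x. f x - g x) + L2_norm M (\<lambda>x. g x - h x)"
  using L2_norm_triangle[OF L2_diff[OF assms(1,2)] L2_diff[OF assms(2,3)]] by simp

lemma L2_norm_tendsto_0:
  assumes "\<And>i. s i \<in> L2 M" "f \<in> L2 M"
    and "\<And>x. x \<in> space M \<Longrightarrow> (\<lambda>i. s i x) \<longlonglongrightarrow> f x"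
    and "\<And>i x. x \<in> space M \<Longrightarrow> (cmod (s i x - f x))\<^sup>2 \<le> w x" "integrable M w"
  shows "(\<lambda>i. L2_norm M (\<lambda>x. s i x - f x)) \<longlonglongrightarrow> 0"
proof -
  note [measurable] = L2_measurable[OF assms(2)] L2_measurable[OF assms(1)]
  have "(\<lambda>i. LINT x|M. (cmod (s i x - f x))\<^sup>2) \<longlonglongrightarrow> (LINT x|M. 0)"
  proof (rule integral_dominated_convergence[where w=w])
    have "(\<lambda>i. (cmod (s i x - f x))\<^sup>2) \<longlonglongrightarrow> 0" if "x \<in> space M" for x
      using tendsto_power[OF tendsto_norm[OF tendsto_diff[OF assms(3)[OF that] tendsto_const[of "f x"]]], of 2]
      by simp
    then show "AE x in M. (\<lambda>i. (cmod (s i x - f x))\<^sup>2) \<longlonglongrightarrow> 0"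
      by (rule AE_I2)
  qed (use assms(4,5) in auto)
  from tendsto_real_sqrt[OF this] show ?thesis by (simp add: L2_norm_def)
qed

section \<open>Density and totality from a generator stable under intersections\<close>

text \<open>Two stages inside the closure \<open>cl\<close> of \<open>V\<close>: the measurable sets
  whose indicator lies in \<open>cl\<close> form a Dynkin system containing the generator
  \<open>E\<close>, hence are all measurable sets; simple functions then approximate
  \<open>f\<close>. It serves twice, for the domain of \<open>dirac\<close> and, through
  \<open>L2_total\<close>, for an orthogonal complement.\<close>

lemma (in finite_measure) L2_dense:
  assumes gen: "sets M = sigma_sets (space M) E" "E \<subseteq> Pow (space M)" "Int_stable E"
    and V: "V \<subseteq> L2 M" "\<And>f g. f \<in> V \<Longrightarrow> g \<in> V \<Longrightarrow> (\<lambda>x. f x + g x) \<in> V"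
      "\<And>f c. f \<in> V \<Longrightarrow> (\<lambda>x. c * f x) \<in> V"
    and ind: "indicator (space M) \<in> V" "\<And>A. A \<in> E \<Longrightarrow> indicator A \<in> V"
    and f: "f \<in> L2 M" and "0 < \<epsilon>"
  shows "\<exists>g\<in>V. L2_norm M (\<lambda>x. f x - g x) < \<epsilon>"
proof -
  define cl where "cl = {f\<in>L2 M. \<forall>\<epsilon>>0. \<exists>g\<in>V. L2_norm M (\<lambda>x. f x - g x) < \<epsilon>}"
  have clD: "\<exists>g\<in>V. L2_norm M (\<lambda>x. f x - g x) < \<epsilon>" if "f \<in> cl" "\<epsilon> > 0" for f \<epsilon>
    using that by (simp add: cl_def)
  have cl_V: "f \<in> cl" if "f \<in> V" for f
    using that V(1) unfolding cl_def by (auto intro!: bexI[of _ f] simp: L2_norm_def)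
  have cl_lim: "f \<in> cl" if f: "f \<in> L2 M" and s: "\<And>i::nat. s i \<in> cl"
    and lim: "(\<lambda>i. L2_norm M (\<lambda>x. s i x - f x)) \<longlonglongrightarrow> 0" for f s
    unfolding cl_def
  proof safe
    fix \<epsilon> :: real assume "\<epsilon> > 0"
    then obtain i where i: "L2_norm M (\<lambda>x. s i x - f x) < \<epsilon> / 2"
      using order_tendstoD(2)[OF lim, of "\<epsilon>/2"] eventually_sequentially by auto
    obtain g where g: "g \<in> V" "L2_norm M (\<lambda>x. s i x - g x) < \<epsilon> / 2"
      using s[of i] \<open>\<epsilon> > 0\<close> unfolding cl_def
        by (auto dest!: spec[of _ "\<epsilon>/2"])
    have "L2_norm M (\<lambda>x. f x - g x) \<le> L2_norm M (\<lambda>x. f x - s i x) + L2_norm M (\<lambda>x. s i x - g x)"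
      using L2_norm_triangle_diff[of f M "s i" g] f s[of i] g(1) V(1) by (auto simp: cl_def)
    then show "\<exists>g\<in>V. L2_norm M (\<lambda>x. f x - g x) < \<epsilon>"
      using i g by (intro bexI[of _ g]) (auto simp: L2_norm_minus_commute[of M f])
  qed (rule f)
  have cl_add: "(\<lambda>x. f x + g x) \<in> cl" if fg: "f \<in> cl" "g \<in> cl" for f g
    unfolding cl_def
  proof safe
    show "(\<lambda>x. f x + g x) \<in> L2 M" using that by (auto simp: cl_def intro: L2_add)
    fix \<epsilon> :: real assume "\<epsilon> > 0"
    then obtain f' g' where *: "f' \<in> V" "g' \<in> V" "L2_norm M (\<lambda>x. f x - f' x) < \<epsilon>/2"
      "L2_norm M (\<lambda>x. g x - g' x) < \<epsilon>/2"
      using clD[OF fg(1), of "\<epsilon>/2"] clD[OF fg(2), of "\<epsilon>/2"] by auto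
    have "L2_norm M (\<lambda>x. (f x - f' x) + (g x - g' x)) < \<epsilon>"
      using L2_norm_triangle[of "\<lambda>x. f x - f' x" M "\<lambda>x. g x - g' x"] * that V(1)
      by (auto simp: cl_def L2_diff subset_iff)
    then show "\<exists>h\<in>V. L2_norm M (\<lambda>x. f x + g x - h x) < \<epsilon>"
      using * V(2) by (intro bexI[of _ "\<lambda>x. f' x + g' x"]) (auto simp: algebra_simps)
  qed
  have cl_scale: "(\<lambda>x. c * f x) \<in> cl" if fc: "f \<in> cl" for f c
    unfolding cl_def
  proof safe
    show "(\<lambda>x. c * f x) \<in> L2 M" using that by (auto simp: cl_def intro: L2_scale)
    fix \<epsilon> :: real assume "\<epsilon> > 0"
    then obtain f' where *: "f' \<in> V" "L2_norm M (\<lambda>x. f x - f' x) < \<epsilon>/(cmod c + 1)"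
      using clD[OF fc, of "\<epsilon>/(cmod c + 1)"] by (auto simp: add_nonneg_pos)
    have "L2_norm M (\<lambda>x. c * (f x - f' x)) \<le> cmod c * (\<epsilon>/(cmod c + 1))"
      unfolding L2_norm_scale using * by (intro mult_left_mono) auto
    also have "\<dots> < \<epsilon>"
    proof -
      have "cmod c + 1 > 0" by (simp add: add_nonneg_pos)
      then show ?thesis using \<open>\<epsilon> > 0\<close> by (simp add: pos_divide_less_eq)
    qed
    finally show "\<exists>h\<in>V. L2_norm M (\<lambda>x. c * f x - h x) < \<epsilon>"
      using * V(3) by (intro bexI[of _ "\<lambda>x. c * f' x"]) (auto simp: algebra_simps)
  qed
  have cl_sum: "(\<lambda>x. \<Sum>i\<in>I. g i x) \<in> cl" if "finite I" "\<And>i. i \<in> I \<Longrightarrow> g i \<in> cl" for I :: "'i set" and g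
    using that
  proof (induction I rule: finite_induct)
    case empty
    have "(\<lambda>x. 0 * indicator (space M) x) \<in> V" using V(3) ind(1) by blast
    then show ?case by (auto intro: cl_V)
  next
    case (insert i I)
    then show ?case using cl_add[of "g i" "\<lambda>x. \<Sum>i\<in>I. g i x"] by simp
  qed
  have cl_ind: "indicator A \<in> cl" if "A \<in> sets M" for A
  proof -
    have A: "A \<in> sigma_sets (space M) E" using that gen by simp
    show ?thesis
    proof (rule sigma_sets_induct_disjoint[OF gen(3,2) A])
      fix A assume "A \<in> E" then show "(indicator A :: _ \<Rightarrow> complex) \<in> cl"
        using ind cl_V by blast
    next
      show "(indicator {} :: _ \<Rightarrow> complex) \<in> cl"
        using cl_sum[of "{}"] by (simp add: indicator_def[abs_def])
    next
      fix A assume A: "A \<in> sigma_sets (space M) E" and *: "(indicator A :: _ \<Rightarrow> complex) \<in> cl"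
      have "A \<subseteq> space M" using A gen sets.sets_into_space by blast
      then have "(indicator (space M - A) :: _ \<Rightarrow> complex) = (\<lambda>x. indicator (space M) x + (-1) * indicator A x)"
        by (auto simp: indicator_def fun_eq_iff)
      then show "(indicator (space M - A) :: _ \<Rightarrow> complex) \<in> cl"
        using cl_add[OF cl_V[OF ind(1)] cl_scale[OF *, of "-1"]] by simp
    next
      fix A :: "nat \<Rightarrow> 'a set"
      assume A: "disjoint_family A" "range A \<subseteq> sigma_sets (space M) E" and *: "\<And>i. (indicator (A i) :: _ \<Rightarrow> complex) \<in> cl"
      have [measurable]: "A i \<in> sets M" for i using A gen by auto
      have eq: "(indicator (\<Union>i<n. A i) :: _ \<Rightarrow> complex) = (\<lambda>x. \<Sum>i<n. indicator (A i) x)" for n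
        using indicator_UN_disjoint[of "{..<n}" A] A(1) by (auto simp: fun_eq_iff disjoint_family_on_def)
      show "(indicator (\<Union>i. A i) :: _ \<Rightarrow> complex) \<in> cl"
      proof (rule cl_lim[where s="\<lambda>n. indicator (\<Union>i<n. A i)"])
        show "(indicator (\<Union>i<n. A i) :: _ \<Rightarrow> complex) \<in> cl" for n
          unfolding eq by (rule cl_sum) (use * in auto)
        show "(\<lambda>n. L2_norm M (\<lambda>x. indicator (\<Union>i<n. A i) x - indicator (\<Union>i. A i) x)) \<longlonglongrightarrow> 0"
        proof (rule L2_norm_tendsto_0[where w="\<lambda>x. 1"])
          fix n x
          show "(cmod (indicator (\<Union>i<n. A i) x - indicator (\<Union>i. A i) x))\<^sup>2 \<le> 1"
            by (cases "x \<in> (\<Union>i<n. A i)"; cases "x \<in> (\<Union>i. A i)") (simp_all add: indicator_def)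
        qed (auto intro!: L2_indicator LIMSEQ_indicator_UN)
      qed (auto intro!: L2_indicator)
    qed
  qed
  have "f \<in> cl"
  proof -
    obtain s where s': "\<forall>i. simple_function M (s i)" "\<forall>x\<in>space M. (\<lambda>i. s i x) \<longlonglongrightarrow> f x"
      "\<forall>i. \<forall>x\<in>space M. dist (s i x) 0 \<le> 2 * dist (f x) 0"
      using borel_measurable_implies_sequence_metric[OF L2_measurable[OF f], of 0] by blast
    then have s: "\<And>i. simple_function M (s i)" "\<And>x. x \<in> space M \<Longrightarrow> (\<lambda>i. s i x) \<longlonglongrightarrow> f x"
      "\<And>i x. x \<in> space M \<Longrightarrow> dist (s i x) 0 \<le> 2 * dist (f x) 0"
      by simp_all
    have [measurable]: "s i \<in> borel_measurable M" for i
      using s(1) by (rule borel_measurable_simple_function)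
    \<comment> \<open>The simple function \<open>s i\<close> as a combination of indicators. It
      vanishes off \<open>space M\<close>, so agreement with \<open>s i\<close> is claimed on
      \<open>space M\<close> only.\<close>
    define t where "t i x = (\<Sum>y\<in>s i ` space M. y * indicator (s i -` {y} \<inter> space M) x)" for i x
    have t: "t i \<in> cl" for i
      unfolding t_def[abs_def]
      using s(1)[of i] by (intro cl_sum cl_scale cl_ind) (auto simp: simple_function_def)
    have ts: "t i x = s i x" if "x \<in> space M" for i x
    proof -
      have "t i x = (\<Sum>y\<in>s i ` space M. if y = s i x then y else 0)"
        unfolding t_def using that by (intro sum.cong[OF refl]) (simp add: indicator_def)
      then show ?thesis using simple_functionD(1)[OF s(1)[of i]] that by (simp add: sum.delta)
    qed
    \<comment> \<open>The approximants satisfy |s_i| <= 2 |f|, hence |t_i - f| <= 3 |f|; this is the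
      origin of the factor 9.\<close>
    have "(\<lambda>i. L2_norm M (\<lambda>x. t i x - f x)) \<longlonglongrightarrow> 0"
    proof (rule L2_norm_tendsto_0[where w="\<lambda>x. 9 * (cmod (f x))\<^sup>2"])
      fix i x assume x: "x \<in> space M"
      have "cmod (t i x - f x) \<le> cmod (t i x) + cmod (f x)" by (rule norm_triangle_ineq4)
      also have "\<dots> \<le> 3 * cmod (f x)" using s(3)[OF x, of i] ts[OF x] by simp
      finally have "(cmod (t i x - f x))\<^sup>2 \<le> (3 * cmod (f x))\<^sup>2"
        by (intro power_mono) auto
      then show "(cmod (t i x - f x))\<^sup>2 \<le> 9 * (cmod (f x))\<^sup>2"
        by (simp add: power_mult_distrib)
    next
      show "t i \<in> L2 M" for i using t[of i] by (simp add: cl_def)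
      show "(\<lambda>i. t i x) \<longlonglongrightarrow> f x" if "x \<in> space M" for x
        using s(2)[OF that] ts[OF that] by simp
      show "integrable M (\<lambda>x. 9 * (cmod (f x))\<^sup>2)" using f by (simp add: L2_def)
    qed (rule f)
    then show "f \<in> cl" by (rule cl_lim[OF f t])
  qed
  then show ?thesis using \<open>0 < \<epsilon>\<close> by (rule clD)
qed

text \<open>The vectors orthogonal to \<open>f\<close> form a space to which \<open>L2_dense\<close>
  applies. A member g of it within \<epsilon> of \<open>f\<close> gives ||f||^2 = <f - g, f> <=
  \<epsilon> ||f||.\<close>

lemma (in finite_measure) L2_total:
  assumes gen: "sets M = sigma_sets (space M) E" "E \<subseteq> Pow (space M)" "Int_stable E"
    and f: "f \<in> L2 M"
    and ind: "L2_inner M f (indicator (space M)) = 0" "\<And>A. A \<in> E \<Longrightarrow> L2_inner M f (indicator A) = 0"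
  shows "ae_eq M f (\<lambda>x. 0)"
proof -
  define V where "V = {g\<in>L2 M. L2_inner M g f = 0}"
  have "L2_norm M f \<le> \<epsilon>" if "\<epsilon> > 0" for \<epsilon>
  proof -
    have "\<exists>g\<in>V. L2_norm M (\<lambda>x. f x - g x) < \<epsilon>"
    proof (rule L2_dense[OF gen _ _ _ _ _ f that])
      have "E \<subseteq> sets M" using gen by auto
      then show "indicator (space M) \<in> V" "\<And>A. A \<in> E \<Longrightarrow> indicator A \<in> V"
        using ind L2_inner_commute[of M _ f] unfolding V_def by (auto intro!: L2_indicator)
    qed (use f in \<open>auto simp: V_def L2_add L2_scale L2_inner_add_left L2_inner_scale_left\<close>)
    then obtain g where g: "g \<in> V" "L2_norm M (\<lambda>x. f x - g x) < \<epsilon>" by blast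
    have "complex_of_real ((L2_norm M f)\<^sup>2) = L2_inner M (\<lambda>x. f x - g x) f"
      using g f L2_inner_self[of M f] by (simp add: V_def L2_inner_diff_left)
    then have "(L2_norm M f)\<^sup>2 = cmod (L2_inner M (\<lambda>x. f x - g x) f)"
      by (metis abs_power2 norm_of_real)
    also have "\<dots> \<le> L2_norm M (\<lambda>x. f x - g x) * L2_norm M f"
      using g f by (intro L2_cauchy_schwarz L2_diff) (auto simp: V_def)
    also have "\<dots> \<le> \<epsilon> * L2_norm M f" using g by (intro mult_right_mono) auto
    finally show ?thesis using that
      by (smt (verit) L2_norm_nonneg mult_le_cancel_right power2_eq_square)
  qed
  then have "L2_norm M f \<le> 0" by (rule field_le_epsilon[of _ 0, simplified])
  then show ?thesis using L2_norm_eq_0_iff[OF f] by (simp add: order_antisym)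
qed

section \<open>Bessel's inequality and orthonormal bases\<close>

lemma bessel:
  assumes "finite F" "F \<subseteq> L2 M" "\<And>e e'. e \<in> F \<Longrightarrow> e' \<in> F \<Longrightarrow> L2_inner M e e' = (if e = e' then 1 else 0)"
    and f: "f \<in> L2 M"
  shows "(\<Sum>e\<in>F. (cmod (L2_inner M f e))\<^sup>2) \<le> (L2_norm M f)\<^sup>2"
proof -
  define p where "p x = (\<Sum>e\<in>F. L2_inner M f e * e x)" for x
  have pL: "p \<in> L2 M" unfolding p_def[abs_def] using assms(2) by (intro L2_sum L2_scale) auto
  have pe: "L2_inner M p e = L2_inner M f e" if "e \<in> F" for e
  proof -
    have "L2_inner M p e = (\<Sum>e'\<in>F. L2_inner M (\<lambda>x. L2_inner M f e' * e' x) e)"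
      unfolding p_def[abs_def] using assms(2) that by (intro L2_inner_sum_left L2_scale) auto
    also have "\<dots> = (\<Sum>e'\<in>F. if e' = e then L2_inner M f e' else 0)"
      unfolding L2_inner_scale_left using assms(3) that by (intro sum.cong) auto
    finally show ?thesis using that assms(1) by simp
  qed
  have gp: "L2_inner M p g = (\<Sum>e\<in>F. L2_inner M f e * L2_inner M e g)" if "g \<in> L2 M" for g
  proof -
    have "L2_inner M p g = (\<Sum>e'\<in>F. L2_inner M (\<lambda>x. L2_inner M f e' * e' x) g)"
      unfolding p_def[abs_def] using assms(2) that by (intro L2_inner_sum_left L2_scale) auto
    then show ?thesis by (simp add: L2_inner_scale_left)
  qed
  define S where "S = (\<Sum>e\<in>F. (cmod (L2_inner M f e))\<^sup>2)"
  have pf: "L2_inner M p f = of_real S"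
    unfolding gp[OF f] S_def of_real_sum
    by (rule sum.cong) (simp_all only: complex_norm_square L2_inner_commute[of M _ f])
  have pp: "L2_inner M p p = of_real S"
    unfolding gp[OF pL] S_def of_real_sum
    by (rule sum.cong) (simp_all only: complex_norm_square L2_inner_commute[of M _ p] pe)
  have fp: "L2_inner M f p = of_real S" using pf by (subst L2_inner_commute) simp
  have d: "(\<lambda>x. f x - p x) \<in> L2 M" using f pL by (rule L2_diff)
  have "complex_of_real ((L2_norm M (\<lambda>x. f x - p x))\<^sup>2) =
      L2_inner M f (\<lambda>x. f x - p x) - L2_inner M p (\<lambda>x. f x - p x)"
    unfolding L2_inner_self[symmetric] using f pL d by (intro L2_inner_diff_left) auto
  also have "\<dots> = cnj (L2_inner M (\<lambda>x. f x - p x) f) - cnj (L2_inner M (\<lambda>x. f x - p x) p)"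
    by (simp add: L2_inner_commute[of M _ "\<lambda>x. f x - p x"])
  also have "\<dots> = of_real ((L2_norm M f)\<^sup>2 - S)"
    using f pL by (simp add: L2_inner_diff_left pf pp fp L2_inner_self[of M f])
  finally have "(L2_norm M (\<lambda>x. f x - p x))\<^sup>2 = (L2_norm M f)\<^sup>2 - S"
    using of_real_eq_iff by blast
  then show ?thesis unfolding S_def[symmetric] by (smt (verit) zero_le_power2)
qed

text \<open>Zorn's lemma: a nonzero vector orthogonal to a maximal orthonormal set could be
  normalised and added. Although vectors are represented by functions, two distinct functions that
  agree almost everywhere never belong to the same orthonormal set, since their inner product would
  be 1 instead of 0.\<close>

lemma orthonormal_basis_exists: "\<exists>E. orthonormal_basis M E"
proof -
  define \<O> where "\<O> = {E. E \<subseteq> L2 M \<and> (\<forall>e\<in>E. \<forall>e'\<in>E. L2_inner M e e' = (if e = e' then 1 else 0))}"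
  have "\<exists>E\<in>\<O>. \<forall>X\<in>\<O>. E \<subseteq> X \<longrightarrow> X = E"
  proof (rule subset_Zorn')
    fix C assume "subset.chain \<O> C"
    then have C: "C \<subseteq> \<O>" and lin: "\<And>X Y. X \<in> C \<Longrightarrow> Y \<in> C \<Longrightarrow> X \<subseteq> Y \<or> Y \<subseteq> X"
      by (auto simp: subset_chain_def)
    have "L2_inner M e e' = (if e = e' then 1 else 0)" if e: "e \<in> \<Union>C" "e' \<in> \<Union>C" for e e'
    proof -
      obtain X Y where XY: "X \<in> C" "e \<in> X" "Y \<in> C" "e' \<in> Y" using e by blast
      define Z where "Z = X \<union> Y"
      have "Z \<in> C" using lin[OF XY(1,3)] XY by (auto simp: Z_def Un_absorb1 Un_absorb2)
      then have "Z \<in> \<O>" using C by blast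
      then show ?thesis using XY by (auto simp: \<O>_def Z_def)
    qed
    moreover have "\<Union>C \<subseteq> L2 M" using C by (auto simp: \<O>_def)
    ultimately show "\<Union>C \<in> \<O>" unfolding \<O>_def mem_Collect_eq by blast
  qed
  then obtain E where E: "E \<in> \<O>" and max: "\<And>X. X \<in> \<O> \<Longrightarrow> E \<subseteq> X \<Longrightarrow> X = E" by blast
  have "ae_eq M f (\<lambda>x. 0)" if f: "f \<in> L2 M" "\<And>e. e \<in> E \<Longrightarrow> L2_inner M f e = 0" for f
  proof (rule ccontr)
    assume "\<not> ae_eq M f (\<lambda>x. 0)"
    then have pos: "L2_norm M f > 0" using L2_norm_eq_0_iff[OF f(1)] by (simp add: less_le)
    define g where "g x = complex_of_real (inverse (L2_norm M f)) * f x" for x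
    have g: "g \<in> L2 M" unfolding g_def[abs_def] using f by (intro L2_scale)
    have ge: "L2_inner M g e = 0" "L2_inner M e g = 0" if "e \<in> E" for e
    proof -
      show "L2_inner M g e = 0" unfolding g_def[abs_def] L2_inner_scale_left using f that by simp
      then show "L2_inner M e g = 0" by (subst L2_inner_commute) simp
    qed
    have gg: "L2_inner M g g = 1"
      unfolding L2_inner_self g_def L2_norm_scale using pos by (simp add: norm_inverse)
    have "insert g E \<in> \<O>" using E g ge gg unfolding \<O>_def by force
    from max[OF this] have "g \<in> E" by blast
    then show False using ge gg by force
  qed
  then have "orthonormal_basis M E"
    using E unfolding orthonormal_basis_def \<O>_def mem_Collect_eq by simp
  then show ?thesis ..
qed

section \<open>Equality almost everywhere\<close>

lemma ae_eq_refl: "ae_eq M f f"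
  by (simp add: ae_eq_def)

lemma ae_eq_sym: "ae_eq M f g \<Longrightarrow> ae_eq M g f"
  by (simp add: ae_eq_def eq_commute)

lemma ae_eq_trans:
  assumes "ae_eq M f g" "ae_eq M g h"
  shows "ae_eq M f h"
  using assms unfolding ae_eq_def by eventually_elim simp

lemma ae_eq_add:
  assumes "ae_eq M f f'" "ae_eq M g g'"
  shows "ae_eq M (\<lambda>x. f x + g x) (\<lambda>x. f' x + g' x)"
  using assms unfolding ae_eq_def by eventually_elim simp

lemma ae_eq_mult: "ae_eq M f f' \<Longrightarrow> ae_eq M (\<lambda>x. c x * f x) (\<lambda>x. c x * f' x)"
  unfolding ae_eq_def by (elim eventually_mono) simp

lemma ae_eq_space: "(\<And>x. x \<in> space M \<Longrightarrow> f x = g x) \<Longrightarrow> ae_eq M f g"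
  unfolding ae_eq_def by (rule AE_I2)

section \<open>Cosets and Haar measure\<close>

locale vilenkin_haar =
  fixes G :: "('a, 'b) monoid_scheme" (structure) and T :: "'a topology"
    and H :: "nat \<Rightarrow> 'a set" and M :: "'a measure"
  assumes topological_group: "topological_group G T"
    and vilenkin: "vilenkin_sequence G T H"
    and haar: "haar_probability G T M"
begin

sublocale group G
  using topological_group by (simp add: topological_group_def)

sublocale prob_space M
  using haar by (simp add: haar_probability_def)

definition cs :: "nat \<Rightarrow> 'a \<Rightarrow> 'a set" where
  "cs k x = x <# H k"

text \<open>The reciprocal of the index of \<open>H k\<close> (see \<open>card_cosets\<close>), as
  left invariance gives all cosets of \<open>H k\<close> the same measure.\<close>

definition mass :: "nat \<Rightarrow> real" where
  "mass k = measure M (H k)"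

lemma space_M: "space M = carrier G" and topspace_T: "topspace T = carrier G"
  using haar topological_group by (simp_all add: haar_probability_def topological_group_def)

lemma sets_M: "sets M = sigma_sets (carrier G) {U. openin T U}"
  using haar topspace_T by (simp add: haar_probability_def)

lemma H_0: "H 0 = carrier G"
  using vilenkin by (simp add: vilenkin_sequence_def)

lemma H_normal: "H k \<lhd> G" and H_open: "openin T (H k)"
  using vilenkin by (simp_all add: vilenkin_sequence_def)

lemma H_subgroup: "subgroup (H k) G"
  using H_normal by (rule normal_imp_subgroup)

lemma H_Suc: "H (Suc k) \<subset> H k"
  using vilenkin by (simp add: vilenkin_sequence_def)

lemma H_mono: "k \<le> n \<Longrightarrow> H n \<subseteq> H k"
  by (rule lift_Suc_antimono_le[of H]) (use H_Suc in auto)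

lemma H_basis: "openin T U \<Longrightarrow> \<one> \<in> U \<Longrightarrow> \<exists>n. H n \<subseteq> U"
  using vilenkin by (simp add: vilenkin_sequence_def)

lemma H_carrier: "H k \<subseteq> carrier G"
  using H_subgroup by (rule subgroup.subset)

lemma cs_iff: "x \<in> carrier G \<Longrightarrow> y \<in> carrier G \<Longrightarrow> y \<in> cs k x \<longleftrightarrow> inv x \<otimes> y \<in> H k"
  unfolding cs_def l_coset_def
  by (auto simp: m_assoc[symmetric] subgroup.mem_carrier[OF H_subgroup] intro!: bexI[of _ "inv x \<otimes> y"])

lemma cs_subset: "x \<in> carrier G \<Longrightarrow> cs k x \<subseteq> carrier G"
  unfolding cs_def by (rule l_coset_subset_G[OF H_carrier])

lemma cs_carrier: "y \<in> cs k x \<Longrightarrow> x \<in> carrier G \<Longrightarrow> y \<in> carrier G"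
  using cs_subset by blast

lemma cs_self: "x \<in> carrier G \<Longrightarrow> x \<in> cs k x"
  by (simp add: cs_iff subgroup.one_closed[OF H_subgroup])

lemma cs_eq: "y \<in> cs k x \<Longrightarrow> x \<in> carrier G \<Longrightarrow> cs k y = cs k x"
  unfolding cs_def using l_repr_independence[OF _ _ H_subgroup] by blast

lemma cs_sym: "y \<in> cs k x \<Longrightarrow> x \<in> carrier G \<Longrightarrow> x \<in> cs k y"
  using cs_eq cs_self by blast

lemma cs_mono: "k \<le> n \<Longrightarrow> cs n x \<subseteq> cs k x"
  unfolding cs_def l_coset_def using H_mono by blast

lemma cs_0: "x \<in> carrier G \<Longrightarrow> cs 0 x = carrier G"
  using cs_subset[of x 0] by (auto simp: cs_iff H_0)

lemma cs_one: "cs k \<one> = H k"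
  unfolding cs_def using lcos_mult_one[OF H_carrier] by simp

lemma left_translation_continuous: "x \<in> carrier G \<Longrightarrow> continuous_map T T (\<lambda>y. x \<otimes> y)"
  using continuous_map_compose[of T "prod_topology T T" "\<lambda>y. (x, y)" T "\<lambda>(x, y). x \<otimes> y"]
    topological_group topspace_T
  by (simp add: topological_group_def o_def continuous_map_pairwise)

lemma cs_open:
  assumes "x \<in> carrier G"
  shows "openin T (cs k x)"
proof -
  have "cs k x = {y \<in> topspace T. inv x \<otimes> y \<in> H k}"
    using assms cs_iff cs_subset[OF assms, of k] by (auto simp: topspace_T)
  then show ?thesis
    using openin_continuous_map_preimage[OF left_translation_continuous H_open] assms by simp
qed

lemma open_sets: "openin T U \<Longrightarrow> U \<in> sets M"
  by (auto simp: sets_M)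

lemma cs_sets [measurable]: "x \<in> carrier G \<Longrightarrow> cs k x \<in> sets M"
  by (simp add: open_sets cs_open)

lemma cs_emeasure: "x \<in> carrier G \<Longrightarrow> emeasure M (cs k x) = emeasure M (H k)"
  unfolding cs_def using haar open_sets[OF H_open] by (simp add: haar_probability_def)

lemma cs_measure: "x \<in> carrier G \<Longrightarrow> measure M (cs k x) = mass k"
  by (simp add: mass_def measure_def cs_emeasure)

lemma cosets_disjoint: "disjoint_family_on (\<lambda>C. C) (cs k ` carrier G)"
proof -
  have "cs k x \<inter> cs k y = {}" if "x \<in> carrier G" "y \<in> carrier G" "cs k x \<noteq> cs k y" for x y
    using that cs_eq[of _ k x] cs_eq[of _ k y] by blast
  then show ?thesis by (auto simp: disjoint_family_on_def)
qed

text \<open>The cosets cover the compact group by nonempty, pairwise disjoint open sets, and such a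
  cover has no proper subcover.\<close>

lemma finite_cosets: "finite (cs k ` carrier G)"
proof -
  have "compactin T (carrier G)"
    using vilenkin H_0 unfolding vilenkin_sequence_def by metis
  moreover have "carrier G \<subseteq> \<Union>(cs k ` carrier G)" using cs_self by blast
  moreover have "openin T C" if "C \<in> cs k ` carrier G" for C using that cs_open by blast
  ultimately have "\<exists>F. finite F \<and> F \<subseteq> cs k ` carrier G \<and> carrier G \<subseteq> \<Union>F"
    unfolding compactin_def by simp
  then obtain F where F: "finite F" "F \<subseteq> cs k ` carrier G" "carrier G \<subseteq> \<Union>F" by blast
  have "cs k ` carrier G \<subseteq> F"
  proof safe
    fix x assume x: "x \<in> carrier G"
    then obtain C where "C \<in> F" "x \<in> C" using F by blast
    then show "cs k x \<in> F" using F(2) cs_eq by fastforce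
  qed
  then show ?thesis using F(1) finite_subset by blast
qed

lemma card_cosets: "real (card (cs k ` carrier G)) * mass k = 1"
proof -
  have "(\<Union>C\<in>cs k ` carrier G. C) = carrier G"
    using cs_self cs_subset by blast
  then have "1 = measure M (\<Union>C\<in>cs k ` carrier G. C)"
    using prob_space by (simp add: space_M)
  also have "\<dots> = (\<Sum>C\<in>cs k ` carrier G. measure M C)"
    by (rule finite_measure_finite_Union[OF finite_cosets _ cosets_disjoint]) auto
  also have "\<dots> = (\<Sum>C\<in>cs k ` carrier G. mass k)"
    by (rule sum.cong) (auto simp: cs_measure)
  finally show ?thesis by simp
qed

lemma mass_pos: "0 < mass k"
  using card_cosets[of k] measure_nonneg[of M "H k"]
    by (cases "mass k = 0") (auto simp: mass_def less_le)

lemma mass_0: "mass 0 = 1"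
  using prob_space by (simp add: mass_def H_0 space_M)

text \<open>Cosets form a tree under inclusion. This is what makes \<open>cosets\<close> stable
  under intersection and lets \<open>coset_integral_one_cs\<close> be computed.\<close>

lemma cs_Int:
  assumes "x \<in> carrier G" "y \<in> carrier G" "k \<le> n"
  shows "cs k x \<inter> cs n y = (if y \<in> cs k x then cs n y else {})"
proof (cases "y \<in> cs k x")
  case True
  then show ?thesis using cs_mono[OF assms(3), of y] cs_eq[OF True assms(1)] by auto
next
  case False
  have "z \<notin> cs n y" if "z \<in> cs k x" for z
    using cs_mono[OF assms(3), of y] cs_eq[OF that assms(1)] cs_eq[of z k y] cs_self[OF assms(2), of k]
      False assms(2) by auto
  then show ?thesis using False by auto
qed

text \<open>The proper inclusion provides a second coset of \<open>H (Suc k)\<close> inside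
  \<open>H k\<close>, disjoint from the first and of the same measure. Iterated, this is the decay
  2^-k on which the summability of the eigenvalues rests.\<close>

lemma mass_Suc: "mass (Suc k) \<le> mass k / 2"
proof -
  obtain a where a: "a \<in> H k" "a \<notin> H (Suc k)" using H_Suc by blast
  have aG: "a \<in> carrier G" using a H_carrier by blast
  have "cs (Suc k) a \<subseteq> H k"
    using cs_mono[of k "Suc k" a] cs_eq[of a k \<one>] a by (simp add: cs_one)
  moreover have "cs (Suc k) a \<inter> H (Suc k) = {}"
    using cs_Int[of \<one> a "Suc k" "Suc k"] aG a(2) by (simp add: cs_one Int_commute)
  moreover have "H (Suc k) \<subseteq> H k" using H_Suc by blast
  ultimately have "measure M (cs (Suc k) a) + measure M (H (Suc k)) \<le> measure M (H k)"
    using finite_measure_Union[OF cs_sets[OF aG] open_sets[OF H_open], of "Suc k" "Suc k"]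
      finite_measure_mono[OF _ open_sets[OF H_open], of "cs (Suc k) a \<union> H (Suc k)" k] by simp
  then show ?thesis using cs_measure[OF aG] by (simp add: mass_def)
qed

lemma mass_le_half_power: "mass k \<le> (1/2)^k"
proof (induction k)
  case (Suc k)
  then show ?case using mass_Suc[of k] by simp
qed (simp add: mass_0)

lemma mass_decseq: "decseq mass"
  using mass_Suc mass_pos by (intro decseq_SucI) (smt (verit) field_sum_of_halves)

lemma mass_le_1: "mass k \<le> 1"
  using mass_decseq mass_0 by (metis decseqD le0)

section \<open>Cosets as a generator of the Borel sets\<close>

definition cosets :: "'a set set" where
  "cosets = insert {} (\<Union>k. cs k ` carrier G)"

lemma countable_cosets: "countable cosets"
  unfolding cosets_def using finite_cosets by (auto intro: countable_finite)

lemma cosets_subset: "cosets \<subseteq> Pow (space M)"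
  unfolding cosets_def space_M using cs_subset by blast

lemma Int_stable_cosets: "Int_stable cosets"
proof (rule Int_stableI)
  have *: "cs k x \<inter> cs n y \<in> cosets" if "x \<in> carrier G" "y \<in> carrier G" "k \<le> n" for k n x y
    using cs_Int[OF that] that by (auto simp: cosets_def)
  fix A B assume "A \<in> cosets" "B \<in> cosets"
  then show "A \<inter> B \<in> cosets"
    unfolding cosets_def
  proof (elim insertE UN_E imageE)
    fix k n x y assume "A = cs k x" "B = cs n y" "x \<in> carrier G" "y \<in> carrier G"
    then show "A \<inter> B \<in> insert {} (\<Union>k. cs k ` carrier G)"
      using *[of x y k n] *[of y x n k] unfolding cosets_def by (metis Int_commute linear)
  qed auto
qed

lemma open_Union_cosets:
  assumes "openin T U"
  shows "U = \<Union>{C\<in>cosets. C \<subseteq> U}"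
proof
  show "U \<subseteq> \<Union>{C\<in>cosets. C \<subseteq> U}"
  proof
    fix x assume x: "x \<in> U"
    then have xG: "x \<in> carrier G" using openin_subset[OF assms] topspace_T by auto
    have "openin T {y \<in> topspace T. x \<otimes> y \<in> U}"
      using left_translation_continuous[OF xG] assms by (rule openin_continuous_map_preimage)
    moreover have "\<one> \<in> {y \<in> topspace T. x \<otimes> y \<in> U}"
      using x xG topspace_T by simp
    ultimately obtain n where "H n \<subseteq> {y \<in> topspace T. x \<otimes> y \<in> U}"
      using H_basis by metis
    then have "cs n x \<subseteq> U" unfolding cs_def l_coset_def by auto
    moreover have "cs n x \<in> cosets" using xG by (auto simp: cosets_def)
    ultimately show "x \<in> \<Union>{C\<in>cosets. C \<subseteq> U}" using cs_self[OF xG] by blast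
  qed
qed auto

text \<open>An open set is the union of the cosets inside it. There are only countably many cosets
  altogether, so that union stays in the generated sigma-algebra.\<close>

lemma sets_M_cosets: "sets M = sigma_sets (space M) cosets"
proof -
  have "cosets \<subseteq> sets M" unfolding cosets_def using cs_sets by auto
  moreover have "U \<in> sigma_sets (space M) cosets" if "openin T U" for U
  proof -
    have "\<Union>{C\<in>cosets. C \<subseteq> U} \<in> sigma_sets (space M) cosets"
    proof (rule sigma_sets_UNION)
      show "countable {C\<in>cosets. C \<subseteq> U}"
        by (rule countable_subset[OF _ countable_cosets]) simp
    qed (simp add: sigma_sets.Basic)
    then show ?thesis unfolding open_Union_cosets[OF that, symmetric] .
  qed
  ultimately show ?thesis
    using sigma_sets_mono[of "{U. openin T U}" "space M" cosets] sets_M space_M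
      sets.sigma_sets_subset[of cosets M] by auto
qed

lemma continuous_measurable:
  fixes f :: "'a \<Rightarrow> 'c::topological_space"
  assumes "continuous_map T euclidean f"
  shows "f \<in> borel_measurable M"
proof (rule borel_measurableI)
  fix S :: "'c set" assume "open S"
  then have "openin T {x \<in> topspace T. f x \<in> S}"
    using openin_continuous_map_preimage[OF assms, of S] by simp
  moreover have "f -` S \<inter> space M = {x \<in> topspace T. f x \<in> S}"
    by (auto simp: space_M topspace_T)
  ultimately show "f -` S \<inter> space M \<in> sets M" by (simp only: open_sets)
qed

lemma locally_constant_measurable:
  fixes f :: "'a \<Rightarrow> 'c::topological_space"
  assumes "\<And>x y. x \<in> carrier G \<Longrightarrow> y \<in> cs n x \<Longrightarrow> f y = f x"
  shows "f \<in> measurable M borel"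
proof (rule continuous_measurable)
  have "openin T {x \<in> topspace T. f x \<in> U}" for U
  proof -
    have "{x \<in> topspace T. f x \<in> U} = \<Union>{cs n x |x. x \<in> carrier G \<and> f x \<in> U}"
    proof safe
      fix x assume "x \<in> topspace T" "f x \<in> U"
      then show "x \<in> \<Union>{cs n x |x. x \<in> carrier G \<and> f x \<in> U}"
        using cs_self[of x n] unfolding topspace_T by blast
    qed (use assms cs_carrier topspace_T in auto)
    also have "openin T \<dots>"
    proof (rule openin_Union)
      fix C assume "C \<in> {cs n x |x. x \<in> carrier G \<and> f x \<in> U}"
      then show "openin T C" using cs_open by blast
    qed
    finally show ?thesis .
  qed
  then show "continuous_map T euclidean f" by (simp add: continuous_map_def)
qed

section \<open>Right translations\<close>

text \<open>Normality of \<open>H k\<close>: the quotient inv (y x) (z x) is the conjugate of inv y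
  z by x.\<close>

lemma right_translate_cs:
  assumes "x \<in> carrier G" "y \<in> carrier G" "z \<in> carrier G"
  shows "z \<otimes> x \<in> cs k (y \<otimes> x) \<longleftrightarrow> z \<in> cs k y"
proof -
  have "inv (y \<otimes> x) \<otimes> (z \<otimes> x) = inv x \<otimes> (inv y \<otimes> z) \<otimes> x"
    using assms by (simp add: inv_mult_group m_assoc)
  moreover have "inv x \<otimes> h \<otimes> x \<in> H k \<longleftrightarrow> h \<in> H k" if "h \<in> carrier G" for h
  proof
    assume "inv x \<otimes> h \<otimes> x \<in> H k"
    then have "x \<otimes> (inv x \<otimes> h \<otimes> x) \<otimes> inv x \<in> H k"
      using normal.inv_op_closed2[OF H_normal assms(1)] by blast
    moreover have "x \<otimes> (inv x \<otimes> h) = h"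
      using assms(1) that by (simp add: m_assoc[symmetric])
    ultimately show "h \<in> H k" using assms(1) that by (simp add: m_assoc)
  qed (use normal.inv_op_closed1[OF H_normal assms(1)] in blast)
  ultimately show ?thesis using assms by (simp add: cs_iff)
qed

text \<open>\<open>haar_probability\<close> provides invariance on the left only. By normality the
  preimage of a coset under a right translation is a coset of the same level, hence of the same
  mass, and finite measures that agree on the generator \<open>cosets\<close> are equal.\<close>

lemma right_translation_preserves:
  assumes x: "x \<in> carrier G"
  shows "(\<lambda>y. y \<otimes> x) \<in> measurable M M" "distr M M (\<lambda>y. y \<otimes> x) = M"
proof -
  have pre: "(\<lambda>y. y \<otimes> x) -` cs k y \<inter> space M = cs k (y \<otimes> inv x)" if "y \<in> carrier G" for k y
  proof -
    have "z \<otimes> x \<in> cs k y \<longleftrightarrow> z \<in> cs k (y \<otimes> inv x)" if "z \<in> carrier G" for z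
      using right_translate_cs[of x "y \<otimes> inv x" z k] that x \<open>y \<in> carrier G\<close>
        by (simp add: m_assoc)
    moreover have "cs k (y \<otimes> inv x) \<subseteq> carrier G" using that x by (intro cs_subset) simp
    ultimately show ?thesis unfolding space_M by blast
  qed
  have pre': "(\<lambda>y. y \<otimes> x) -` A \<inter> space M \<in> sets M" if "A \<in> cosets" for A
    using that pre x by (auto simp: cosets_def)
  show meas: "(\<lambda>y. y \<otimes> x) \<in> measurable M M"
    by (rule measurable_sigma_sets[OF sets_M_cosets cosets_subset])
       (use pre' x in \<open>auto simp: space_M\<close>)
  show "distr M M (\<lambda>y. y \<otimes> x) = M"
  proof (rule measure_eqI_generator_eq[OF Int_stable_cosets cosets_subset])
    fix A assume "A \<in> cosets"
    then show "emeasure (distr M M (\<lambda>y. y \<otimes> x)) A = emeasure M A"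
      unfolding cosets_def
    proof (elim insertE UN_E imageE)
      fix k y assume "A = cs k y" "y \<in> carrier G"
      then show ?thesis using x pre[of y k] by (simp add: emeasure_distr[OF meas] cs_emeasure)
    qed simp
  next
    show "sets (distr M M (\<lambda>y. y \<otimes> x)) = sigma_sets (space M) cosets" "sets M = sigma_sets (space M) cosets"
      using sets_M_cosets by simp_all
    show "range (\<lambda>i::nat. space M) \<subseteq> cosets"
      using cs_0[of \<one>] by (auto simp: cosets_def space_M)
    interpret D: prob_space "distr M M (\<lambda>y. y \<otimes> x)" by (rule prob_space_distr[OF meas])
    show "emeasure (distr M M (\<lambda>y. y \<otimes> x)) (space M) \<noteq> \<infinity>"
      using D.emeasure_space_1 by simp
  qed simp
qed


section \<open>Operators acting by scalars on martingale differences\<close>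

abbreviation one_cs :: "nat \<Rightarrow> 'a \<Rightarrow> 'a \<Rightarrow> complex" where
  "one_cs k x \<equiv> indicator (cs k x)"

text \<open>This is \<open>mass k\<close> times the conditional expectation of level k. Without the
  division the bound by the norm of \<open>u\<close> is uniform in k
  (\<open>coset_integral_bound\<close>). As an inner product it inherits linearity and the
  Cauchy-Schwarz inequality.\<close>

definition coset_integral :: "nat \<Rightarrow> ('a \<Rightarrow> complex) \<Rightarrow> 'a \<Rightarrow> complex" where
  "coset_integral k u x = L2_inner M u (one_cs k x)"

lemma one_cs_L2: "x \<in> carrier G \<Longrightarrow> one_cs k x \<in> L2 M"
  by (intro L2_indicator cs_sets)

lemma L2_inner_indicator:
  assumes "A \<in> sets M" "C \<in> sets M"
  shows "L2_inner M (indicator A) (indicator C) = measure M (A \<inter> C)"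
proof -
  have "L2_inner M (indicator A) (indicator C) = (LINT x|M. complex_of_real (indicator (A \<inter> C) x))"
    unfolding L2_inner_def by (rule Bochner_Integration.integral_cong) (auto simp: indicator_def)
  then show ?thesis using assms by (simp add: integral_complex_of_real)
qed

lemma L2_norm_one_cs:
  assumes "x \<in> carrier G"
  shows "(L2_norm M (one_cs k x))\<^sup>2 = mass k"
proof -
  have "complex_of_real ((L2_norm M (one_cs k x))\<^sup>2) = complex_of_real (mass k)"
    unfolding L2_inner_self[symmetric] using assms by (simp add: L2_inner_indicator cs_measure)
  then show ?thesis by (simp only: of_real_eq_iff)
qed

lemma coset_integral_bound:
  assumes "u \<in> L2 M" "x \<in> carrier G"
  shows "cmod (coset_integral k u x) \<le> L2_norm M u"
proof -
  have "L2_norm M (one_cs k x) \<le> 1"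
    by (rule power2_le_imp_le) (simp_all add: L2_norm_one_cs[OF assms(2)] mass_le_1)
  then show ?thesis
    unfolding coset_integral_def using L2_cauchy_schwarz[OF assms(1) one_cs_L2[OF assms(2)], of k]
      mult_left_le[of "L2_norm M (one_cs k x)" "L2_norm M u"] by simp
qed

lemma coset_integral_cs: "x \<in> carrier G \<Longrightarrow> y \<in> cs k x \<Longrightarrow> coset_integral k u y = coset_integral k u x"
  by (simp add: coset_integral_def cs_eq)

lemma coset_integral_measurable: "coset_integral k u \<in> borel_measurable M"
  using coset_integral_cs by (intro locally_constant_measurable[of k])

lemma coset_integral_L2: "u \<in> L2 M \<Longrightarrow> coset_integral k u \<in> L2 M"
  by (rule L2_bounded[OF coset_integral_measurable, where C="L2_norm M u"]) (simp add: space_M coset_integral_bound)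

lemma coset_integral_eq_sum:
  assumes "x \<in> carrier G"
  shows "coset_integral k u x = (\<Sum>C\<in>cs k ` carrier G. L2_inner M u (indicator C) * indicator C x)"
proof -
  have "(\<Sum>C\<in>cs k ` carrier G. L2_inner M u (indicator C) * indicator C x)
      = (\<Sum>C\<in>cs k ` carrier G. if C = cs k x then L2_inner M u (indicator C) else 0)"
  proof (rule sum.cong[OF refl])
    fix C assume "C \<in> cs k ` carrier G"
    then obtain y where y: "C = cs k y" "y \<in> carrier G" by blast
    have "x \<in> C \<longleftrightarrow> C = cs k x"
      using y cs_self[OF assms, of k] cs_eq[of x k y] by blast
    then show "L2_inner M u (indicator C) * indicator C x = (if C = cs k x then L2_inner M u (indicator C) else 0)"
      by (simp add: indicator_def)
  qed
  then show ?thesis using assms finite_cosets[of k] by (simp add: coset_integral_def)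
qed

lemma coset_L2: "C \<in> cs k ` carrier G \<Longrightarrow> indicator C \<in> L2 M"
  using one_cs_L2 by blast

text \<open>The finite-rank form of the operator: symmetry is visible in it, and for u = v it is a
  sum of squares, which is how it enters the trace estimate.\<close>

lemma coset_integral_inner:
  assumes "u \<in> L2 M" "v \<in> L2 M"
  shows "L2_inner M (coset_integral k u) v
    = (\<Sum>C\<in>cs k ` carrier G. L2_inner M u (indicator C) * L2_inner M (indicator C) v)"
proof -
  have "L2_inner M (coset_integral k u) v
      = L2_inner M (\<lambda>x. \<Sum>C\<in>cs k ` carrier G. L2_inner M u (indicator C) * indicator C x) v"
    unfolding L2_inner_def by (rule Bochner_Integration.integral_cong) (auto simp: space_M coset_integral_eq_sum L2_inner_def)
  also have "\<dots> = (\<Sum>C\<in>cs k ` carrier G. L2_inner M (\<lambda>x. L2_inner M u (indicator C) * indicator C x) v)"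
    using assms coset_L2 by (intro L2_inner_sum_left L2_scale) auto
  finally show ?thesis by (simp add: L2_inner_scale_left)
qed

lemma coset_integral_sym:
  assumes "u \<in> L2 M" "v \<in> L2 M"
  shows "L2_inner M (coset_integral k u) v = cnj (L2_inner M (coset_integral k v) u)"
  unfolding coset_integral_inner[OF assms] coset_integral_inner[OF assms(2,1)] cnj_sum
  by (rule sum.cong) (simp_all add: L2_inner_commute[of M "indicator _"])

section \<open>Abel-summed series of coset integrals\<close>

definition coef :: "(nat \<Rightarrow> real) \<Rightarrow> nat \<Rightarrow> real" where
  "coef \<rho> k = (\<rho> k - \<rho> (Suc k)) / mass k"

text \<open>The rank of P_k is at most 1 / \<open>mass k\<close>, so the series dominates the trace
  norm of the operator with eigenvalues \<rho>. It also makes \<open>coef \<rho>\<close> absolutely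
  summable, which gives uniform convergence of \<open>level_op\<close>.\<close>

definition admissible :: "(nat \<Rightarrow> real) \<Rightarrow> bool" where
  "admissible \<rho> \<longleftrightarrow> summable (\<lambda>k. \<bar>\<rho> k\<bar> / mass k)"

text \<open>The Abel-summed form of \<open>\<Sum> \<rho>\<^sub>k P\<^sub>k\<close>; it acts as \<open>\<rho> n\<close> on martingale differences of level \<open>n\<close>
  (see \<open>level_op_level_vector\<close>).\<close>

definition level_op :: "(nat \<Rightarrow> real) \<Rightarrow> ('a \<Rightarrow> complex) \<Rightarrow> 'a \<Rightarrow> complex" where
  "level_op \<rho> u x = (\<Sum>k. complex_of_real (coef \<rho> k) * coset_integral k u x)"

lemma admissible_tendsto: "admissible \<rho> \<Longrightarrow> \<rho> \<longlonglongrightarrow> 0"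
proof -
  assume "admissible \<rho>"
  then have "(\<lambda>k. \<bar>\<rho> k\<bar> / mass k) \<longlonglongrightarrow> 0" unfolding admissible_def
    by (rule summable_LIMSEQ_zero)
  then show "\<rho> \<longlonglongrightarrow> 0"
    by (rule Lim_null_comparison[rotated])
       (intro always_eventually allI, simp add: pos_le_divide_eq mass_pos mass_le_1 mult_left_le)
qed

lemma coef_summable: "admissible \<rho> \<Longrightarrow> summable (\<lambda>k. \<bar>coef \<rho> k\<bar>)"
proof -
  assume a: "admissible \<rho>"
  then have s: "summable (\<lambda>k. \<bar>\<rho> k\<bar> / mass k + \<bar>\<rho> (Suc k)\<bar> / mass (Suc k))"
    unfolding admissible_def
    by (intro summable_add) (simp_all add: summable_Suc_iff[of "\<lambda>k. \<bar>\<rho> k\<bar> / mass k"])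
  have "\<bar>coef \<rho> k\<bar> \<le> \<bar>\<rho> k\<bar> / mass k + \<bar>\<rho> (Suc k)\<bar> / mass (Suc k)" for k
  proof -
    have "\<bar>coef \<rho> k\<bar> \<le> \<bar>\<rho> k\<bar> / mass k + \<bar>\<rho> (Suc k)\<bar> / mass k"
      using mass_pos[of k] by (simp add: coef_def add_divide_distrib[symmetric] divide_right_mono)
    moreover have "\<bar>\<rho> (Suc k)\<bar> / mass k \<le> \<bar>\<rho> (Suc k)\<bar> / mass (Suc k)"
      using mass_pos[of "Suc k"] decseqD[OF mass_decseq, of k "Suc k"]
        by (intro divide_left_mono) (auto intro: mult_pos_pos mass_pos)
    ultimately show ?thesis by simp
  qed
  then show ?thesis by (intro summable_comparison_test[OF _ s]) auto
qed

text \<open>The tail telescopes because \<rho> tends to 0. Exactly the terms from n on survive on a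
  vector of level n, which is why \<open>level_op\<close> has the eigenvalue \<open>\<rho> n\<close>
  there.\<close>

lemma coef_sums: "admissible \<rho> \<Longrightarrow> (\<lambda>k. coef \<rho> (k + n) * mass (k + n)) sums \<rho> n"
proof -
  assume "admissible \<rho>"
  then have "(\<lambda>k. \<rho> (k + n)) \<longlonglongrightarrow> 0"
    using admissible_tendsto LIMSEQ_ignore_initial_segment by blast
  from telescope_sums'[OF this] show ?thesis using mass_pos
    by (simp add: coef_def less_imp_neq[THEN not_sym])
qed

lemma level_op_summable:
  assumes "admissible \<rho>" "u \<in> L2 M" "x \<in> carrier G"
  shows "summable (\<lambda>k. cmod (complex_of_real (coef \<rho> k) * coset_integral k u x))"
    and "cmod (complex_of_real (coef \<rho> k) * coset_integral k u x) \<le> \<bar>coef \<rho> k\<bar> * L2_norm M u"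
proof -
  show *: "cmod (complex_of_real (coef \<rho> k) * coset_integral k u x) \<le> \<bar>coef \<rho> k\<bar> * L2_norm M u" for k
    unfolding norm_mult using coset_integral_bound[OF assms(2,3)] by (simp add: mult_left_mono)
  show "summable (\<lambda>k. cmod (complex_of_real (coef \<rho> k) * coset_integral k u x))"
    by (rule summable_comparison_test[OF _ summable_mult2[OF coef_summable[OF assms(1)]]])
       (use * in auto)
qed

lemma level_op_sums:
  assumes "admissible \<rho>" "u \<in> L2 M" "x \<in> carrier G"
  shows "(\<lambda>k. complex_of_real (coef \<rho> k) * coset_integral k u x) sums level_op \<rho> u x"
  unfolding level_op_def using summable_norm_cancel[OF level_op_summable(1)[OF assms]]
    by (rule summable_sums)

definition coef_norm :: "(nat \<Rightarrow> real) \<Rightarrow> real" where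
  "coef_norm \<rho> = (\<Sum>k. \<bar>coef \<rho> k\<bar>)"

lemma level_op_bound:
  assumes "admissible \<rho>" "u \<in> L2 M" "x \<in> carrier G"
  shows "cmod (level_op \<rho> u x) \<le> coef_norm \<rho> * L2_norm M u"
proof -
  have "cmod (level_op \<rho> u x) \<le> (\<Sum>k. \<bar>coef \<rho> k\<bar> * L2_norm M u)"
    unfolding level_op_def
    by (rule norm_suminf_le[OF level_op_summable(2)[OF assms] summable_mult2[OF coef_summable[OF assms(1)]]])
  then show ?thesis unfolding coef_norm_def using suminf_mult2[OF coef_summable[OF assms(1)]] by simp
qed

lemma coef_norm_nonneg: "admissible \<rho> \<Longrightarrow> 0 \<le> coef_norm \<rho>"
  unfolding coef_norm_def by (rule suminf_nonneg[OF coef_summable]) auto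

lemma level_op_measurable:
  assumes "admissible \<rho>" "u \<in> L2 M"
  shows "level_op \<rho> u \<in> borel_measurable M"
proof (rule borel_measurable_LIMSEQ_metric)
  note [measurable] = coset_integral_measurable
  show "(\<lambda>x. \<Sum>k<n. complex_of_real (coef \<rho> k) * coset_integral k u x) \<in> borel_measurable M" for n
    by measurable
  show "(\<lambda>n. \<Sum>k<n. complex_of_real (coef \<rho> k) * coset_integral k u x) \<longlonglongrightarrow> level_op \<rho> u x" if "x \<in> space M" for x
    using level_op_sums[OF assms] that by (simp add: sums_def space_M)
qed

lemma level_op_L2: "admissible \<rho> \<Longrightarrow> u \<in> L2 M \<Longrightarrow> level_op \<rho> u \<in> L2 M"
  by (rule L2_bounded[OF level_op_measurable, where C="coef_norm \<rho> * L2_norm M u"]) (simp_all add: space_M level_op_bound)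

lemma L2_norm_le_bound:
  assumes "f \<in> borel_measurable M" "\<And>x. x \<in> carrier G \<Longrightarrow> cmod (f x) \<le> c" "0 \<le> c"
  shows "L2_norm M f \<le> c"
proof -
  have "(LINT x|M. (cmod (f x))\<^sup>2) \<le> (LINT x|M. c\<^sup>2)"
  proof (rule integral_mono)
    show "integrable M (\<lambda>x. (cmod (f x))\<^sup>2)"
      using L2_integrable_sq[OF L2_bounded[OF assms(1), of c]] assms(2) by (simp add: space_M)
  qed (use assms in \<open>auto simp: space_M intro: power_mono\<close>)
  then show ?thesis unfolding L2_norm_def using assms(3) prob_space by (intro real_le_lsqrt) auto
qed

lemma level_op_norm: "admissible \<rho> \<Longrightarrow> u \<in> L2 M \<Longrightarrow> L2_norm M (level_op \<rho> u) \<le> coef_norm \<rho> * L2_norm M u"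
  by (rule L2_norm_le_bound) (simp_all add: level_op_measurable level_op_bound coef_norm_nonneg)

lemma coset_integral_cong_AE: "ae_eq M u v \<Longrightarrow> u \<in> L2 M \<Longrightarrow> v \<in> L2 M \<Longrightarrow> x \<in> carrier G \<Longrightarrow> coset_integral k u x = coset_integral k v x"
  unfolding coset_integral_def by (rule L2_inner_cong_AE) (auto simp: one_cs_L2 ae_eq_def)

text \<open>Coset integrals see only the class of a function, so the values agree at every point of
  the group although the arguments agree only almost everywhere.\<close>

lemma level_op_cong_AE: "ae_eq M u v \<Longrightarrow> u \<in> L2 M \<Longrightarrow> v \<in> L2 M \<Longrightarrow> x \<in> carrier G \<Longrightarrow> level_op \<rho> u x = level_op \<rho> v x"
  unfolding level_op_def using coset_integral_cong_AE by simp

lemma level_op_add: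
  assumes "admissible \<rho>" "u \<in> L2 M" "v \<in> L2 M" "x \<in> carrier G"
  shows "level_op \<rho> (\<lambda>x. u x + v x) x = level_op \<rho> u x + level_op \<rho> v x"
proof -
  have "coset_integral k (\<lambda>x. u x + v x) x = coset_integral k u x + coset_integral k v x" for k
    unfolding coset_integral_def using assms by (intro L2_inner_add_left one_cs_L2)
  then have "(\<lambda>k. complex_of_real (coef \<rho> k) * coset_integral k (\<lambda>x. u x + v x) x) sums (level_op \<rho> u x + level_op \<rho> v x)"
    using sums_add[OF level_op_sums[OF assms(1,2,4)] level_op_sums[OF assms(1,3,4)]]
      by (simp add: distrib_left)
  then show ?thesis
    using sums_unique2[OF level_op_sums[OF assms(1) L2_add[OF assms(2,3)] assms(4)]] by blast
qed

lemma level_op_scale: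
  assumes "admissible \<rho>" "u \<in> L2 M" "x \<in> carrier G"
  shows "level_op \<rho> (\<lambda>x. c * u x) x = c * level_op \<rho> u x"
proof -
  have "coset_integral k (\<lambda>x. c * u x) x = c * coset_integral k u x" for k
    unfolding coset_integral_def by (rule L2_inner_scale_left)
  then have "(\<lambda>k. complex_of_real (coef \<rho> k) * coset_integral k (\<lambda>x. c * u x) x) sums (c * level_op \<rho> u x)"
    using sums_mult[OF level_op_sums[OF assms(1,2,3)], of c] by (simp add: mult.left_commute)
  then show ?thesis
    using sums_unique2[OF level_op_sums[OF assms(1) L2_scale[OF assms(2)] assms(3)]] by blast
qed

text \<open>Sum and integral may be interchanged: the modulus of the k-th term integrates to at most
  |\<open>coef \<rho> k\<close>| ||u|| times the integral of |v|, and \<open>v\<close> is integrable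
  on a probability space.\<close>

lemma level_op_inner_sums:
  assumes "admissible \<rho>" "u \<in> L2 M" "v \<in> L2 M"
  shows "(\<lambda>k. complex_of_real (coef \<rho> k) * L2_inner M (coset_integral k u) v) sums L2_inner M (level_op \<rho> u) v"
proof -
  have int: "integrable M (\<lambda>x. complex_of_real (coef \<rho> k) * coset_integral k u x * cnj (v x))" for k
    using L2_integrable_inner(1)[OF L2_scale[OF coset_integral_L2[OF assms(2)]] assms(3)] by simp
  have sm: "summable (\<lambda>k. norm (complex_of_real (coef \<rho> k) * coset_integral k u x * cnj (v x)))" if "x \<in> carrier G" for x
    using summable_mult2[OF level_op_summable(1)[OF assms(1,2) that], of "cmod (v x)"]
      by (simp add: norm_mult)
  have "(\<lambda>k. LINT x|M. complex_of_real (coef \<rho> k) * coset_integral k u x * cnj (v x))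
      sums (LINT x|M. (\<Sum>k. complex_of_real (coef \<rho> k) * coset_integral k u x * cnj (v x)))"
  proof (rule sums_integral[OF int])
    show "AE x in M. summable (\<lambda>k. norm (complex_of_real (coef \<rho> k) * coset_integral k u x * cnj (v x)))"
      using sm by (intro AE_I2) (simp add: space_M)
    have n: "norm (\<integral>x. norm (complex_of_real (coef \<rho> k) * coset_integral k u x * cnj (v x)) \<partial>M)
        \<le> \<bar>coef \<rho> k\<bar> * (L2_norm M u * (LINT x|M. cmod (v x)))" for k
    proof -
      have "(\<integral>x. norm (complex_of_real (coef \<rho> k) * coset_integral k u x * cnj (v x)) \<partial>M)
          \<le> (\<integral>x. \<bar>coef \<rho> k\<bar> * L2_norm M u * cmod (v x) \<partial>M)"
      proof (rule integral_mono)
        fix x assume "x \<in> space M"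
        then show "norm (complex_of_real (coef \<rho> k) * coset_integral k u x * cnj (v x)) \<le> \<bar>coef \<rho> k\<bar> * L2_norm M u * cmod (v x)"
          using level_op_summable(2)[OF assms(1,2), of x k]
            by (simp add: space_M norm_mult mult_right_mono)
      qed (use int L2_integrable[OF assms(3)] in auto)
      then show ?thesis by (simp add: mult.assoc)
    qed
    show "summable (\<lambda>k. \<integral>x. norm (complex_of_real (coef \<rho> k) * coset_integral k u x * cnj (v x)) \<partial>M)"
      by (rule summable_comparison_test[OF _ summable_mult2[OF coef_summable[OF assms(1)]]])
         (use n in auto)
  qed
  moreover have "(LINT x|M. (\<Sum>k. complex_of_real (coef \<rho> k) * coset_integral k u x * cnj (v x))) = L2_inner M (level_op \<rho> u) v"
    unfolding L2_inner_def level_op_def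
    by (rule Bochner_Integration.integral_cong)
       (use suminf_mult2[OF summable_norm_cancel[OF level_op_summable(1)[OF assms(1,2)]]] in \<open>auto simp: space_M\<close>)
  ultimately show ?thesis
    by (simp add: L2_inner_def mult.assoc)
qed

lemma level_op_sym:
  assumes "admissible \<rho>" "u \<in> L2 M" "v \<in> L2 M"
  shows "L2_inner M (level_op \<rho> u) v = L2_inner M u (level_op \<rho> v)"
proof -
  have "(\<lambda>k. complex_of_real (coef \<rho> k) * L2_inner M (coset_integral k u) v) sums cnj (L2_inner M (level_op \<rho> v) u)"
    using level_op_inner_sums[OF assms(1,3,2)]
      by (subst (asm) sums_cnj[symmetric]) (simp add: coset_integral_sym[OF assms(2,3)])
  then show ?thesis
    using sums_unique2[OF level_op_inner_sums[OF assms]] L2_inner_commute[of M u] by simp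
qed


section \<open>Vectors of a single level and their totality\<close>

text \<open>The range of P_n: all integrals over cosets of levels below n vanish, and from level n
  on the function is constant on cosets. The condition is imposed at every point, which selects the
  locally constant representative, and it is phrased by coset integrals so that the series
  \<open>level_op\<close> can be evaluated term by term.\<close>

definition level_vector :: "nat \<Rightarrow> ('a \<Rightarrow> complex) \<Rightarrow> bool" where
  "level_vector n e \<longleftrightarrow> e \<in> L2 M \<and>
     (\<forall>x\<in>carrier G. \<forall>k. coset_integral k e x = (if k < n then 0 else complex_of_real (mass k) * e x))"

lemma level_vector_L2: "level_vector n e \<Longrightarrow> e \<in> L2 M"
  by (simp add: level_vector_def)

lemma level_op_level_vector:
  assumes "admissible \<rho>" "level_vector n e" "x \<in> carrier G"
  shows "level_op \<rho> e x = complex_of_real (\<rho> n) * e x"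
proof -
  let ?f = "\<lambda>k. complex_of_real (coef \<rho> k) * coset_integral k e x"
  have coset_integral: "coset_integral k e x = (if k < n then 0 else complex_of_real (mass k) * e x)" for k
    using assms by (simp add: level_vector_def)
  have "(\<lambda>k. complex_of_real (coef \<rho> (k + n) * mass (k + n))) sums complex_of_real (\<rho> n)"
    using coef_sums[OF assms(1)] by (rule sums_of_real)
  from sums_mult2[OF this, of "e x"] have "(\<lambda>k. ?f (k + n)) sums (complex_of_real (\<rho> n) * e x)"
    by (simp add: coset_integral mult.assoc)
  moreover have "(\<Sum>k<n. ?f k) = 0" by (simp add: coset_integral)
  ultimately have "?f sums (complex_of_real (\<rho> n) * e x)"
    using sums_iff_shift[of ?f n "complex_of_real (\<rho> n) * e x"] by simp
  then show ?thesis
    using sums_unique2[OF level_op_sums[OF assms(1) level_vector_L2[OF assms(2)] assms(3)]] by blast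
qed

lemma level_op_inner_level_vector:
  assumes "admissible \<rho>" "level_vector n e" "u \<in> L2 M"
  shows "L2_inner M (level_op \<rho> u) e = complex_of_real (\<rho> n) * L2_inner M u e"
proof -
  have "L2_inner M (level_op \<rho> u) e = L2_inner M u (level_op \<rho> e)"
    using assms level_vector_L2 by (intro level_op_sym)
  also have "\<dots> = L2_inner M u (\<lambda>x. complex_of_real (\<rho> n) * e x)"
    unfolding L2_inner_def
    by (rule Bochner_Integration.integral_cong) (simp_all add: space_M level_op_level_vector[OF assms(1,2)])
  finally show ?thesis by (simp add: L2_inner_scale_right)
qed

lemma measure_cs_Int:
  assumes "x \<in> carrier G" "y \<in> carrier G" "k \<le> n"
  shows "measure M (cs k x \<inter> cs n y) = (if y \<in> cs k x then mass n else 0)"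
  using assms by (simp add: cs_Int cs_measure)

lemma coset_integral_one_cs:
  assumes "x \<in> carrier G" "y \<in> carrier G"
  shows "k \<le> n \<Longrightarrow> coset_integral k (one_cs n x) y = complex_of_real (mass n) * one_cs k x y"
    and "n \<le> k \<Longrightarrow> coset_integral k (one_cs n x) y = complex_of_real (mass k) * one_cs n x y"
proof -
  have *: "coset_integral k (one_cs n x) y = measure M (cs n x \<inter> cs k y)"
    unfolding coset_integral_def using assms by (intro L2_inner_indicator cs_sets)
  have sym: "x \<in> cs k y \<longleftrightarrow> y \<in> cs k x" using assms cs_sym by blast
  show "k \<le> n \<Longrightarrow> coset_integral k (one_cs n x) y = complex_of_real (mass n) * one_cs k x y"
    unfolding * using measure_cs_Int[OF assms(2,1), of k n] sym
    by (simp add: Int_commute indicator_def)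
  show "n \<le> k \<Longrightarrow> coset_integral k (one_cs n x) y = complex_of_real (mass k) * one_cs n x y"
    unfolding * using measure_cs_Int[OF assms, of n k] by (simp add: indicator_def)
qed

lemma level_vector_0: "level_vector 0 (one_cs 0 \<one>)"
  unfolding level_vector_def using coset_integral_one_cs(2)[of \<one> _ 0] by (simp add: one_cs_L2)

text \<open>The vector is the indicator of a coset minus its conditional expectation one level up
  the tree, that is, its image under P_(n+1), a Haar-type function.\<close>

lemma level_vector_Suc:
  assumes x: "x \<in> carrier G"
  shows "level_vector (Suc n) (\<lambda>y. one_cs (Suc n) x y - complex_of_real (mass (Suc n) / mass n) * one_cs n x y)"
    (is "level_vector _ ?e")
  unfolding level_vector_def
proof (intro conjI ballI allI)
  show "?e \<in> L2 M" using x by (intro L2_diff L2_scale one_cs_L2)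
  fix y k assume y: "y \<in> carrier G"
  have "coset_integral k ?e y = coset_integral k (one_cs (Suc n) x) y - complex_of_real (mass (Suc n) / mass n) * coset_integral k (one_cs n x) y"
    unfolding coset_integral_def using x y
    by (simp only: L2_inner_diff_left[OF one_cs_L2 L2_scale[OF one_cs_L2] one_cs_L2] L2_inner_scale_left)
  then show "coset_integral k ?e y = (if k < Suc n then 0 else complex_of_real (mass k) * ?e y)"
    using x y mass_pos[of n] by (cases "k \<le> n") (simp_all add: coset_integral_one_cs right_diff_distrib)
qed

text \<open>Starting from the constant function 1, the indicator of a coset of level n + 1 is a
  vector of that level plus a multiple of an indicator of level n. So \<open>f\<close> is orthogonal
  to all coset indicators, and these generate.\<close>

lemma level_vector_total:
  assumes f: "f \<in> L2 M" and *: "\<And>n e. level_vector n e \<Longrightarrow> L2_inner M f e = 0"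
  shows "ae_eq M f (\<lambda>x. 0)"
proof -
  have 0: "L2_inner M f (one_cs n x) = 0" if "x \<in> carrier G" for n x
  proof (induction n)
    case 0
    show ?case using *[OF level_vector_0] cs_0 that by (simp add: cs_0)
  next
    case (Suc n)
    let ?e = "\<lambda>y. one_cs (Suc n) x y - complex_of_real (mass (Suc n) / mass n) * one_cs n x y"
    have "L2_inner M ?e f = L2_inner M (one_cs (Suc n) x) f - complex_of_real (mass (Suc n) / mass n) * L2_inner M (one_cs n x) f"
      using that f by (simp only: L2_inner_diff_left[OF one_cs_L2 L2_scale[OF one_cs_L2] f] L2_inner_scale_left)
    moreover have "L2_inner M ?e f = 0" "L2_inner M (one_cs n x) f = 0"
      using *[OF level_vector_Suc[OF that]] Suc L2_inner_commute[of M _ f] by simp_all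
    ultimately show ?case using L2_inner_commute[of M f "one_cs (Suc n) x"] by simp
  qed
  show ?thesis
  proof (rule L2_total[OF sets_M_cosets cosets_subset Int_stable_cosets f])
    show "L2_inner M f (indicator (space M)) = 0" using 0[of \<one> 0] by (simp add: cs_0 space_M)
    fix A assume "A \<in> cosets"
    then show "L2_inner M f (indicator A) = 0"
      unfolding cosets_def using 0 by (auto simp: L2_inner_def)
  qed
qed

text \<open>Used with \<open>level_op_inner_level_vector\<close> it substitutes for diagonalisation:
  identities between combinations of the operators \<open>level_op\<close> are checked on their
  scalars at each level.\<close>

lemma level_vector_total_eq:
  assumes "f \<in> L2 M" "g \<in> L2 M" "\<And>n e. level_vector n e \<Longrightarrow> L2_inner M f e = L2_inner M g e"
  shows "ae_eq M f g"
proof -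
  have "ae_eq M (\<lambda>x. f x - g x) (\<lambda>x. 0)"
    using assms by (intro level_vector_total L2_diff) (simp_all add: L2_inner_diff_left level_vector_L2)
  then show ?thesis by (simp add: ae_eq_def)
qed

text \<open>Since \<rho> is constant up to n, the coefficients below n vanish. What remains are
  integrals over cosets of level at least n, on which \<open>f\<close> is a constant that can be
  pulled out.\<close>

lemma level_op_local:
  assumes u: "u \<in> L2 M" and admissible: "admissible \<rho>" and f: "\<And>x y. x \<in> carrier G \<Longrightarrow> y \<in> cs n x \<Longrightarrow> f y = f x"
    and \<rho>: "\<And>k. k \<le> n \<Longrightarrow> \<rho> k = \<rho> n" and x: "x \<in> carrier G"
  shows "level_op \<rho> (\<lambda>y. f y * u y) x = f x * level_op \<rho> u x"
proof -
  have "complex_of_real (coef \<rho> k) * coset_integral k (\<lambda>y. f y * u y) x = f x * (complex_of_real (coef \<rho> k) * coset_integral k u x)" for k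
  proof (cases "k < n")
    case True
    then show ?thesis using \<rho>[of k] \<rho>[of "Suc k"] by (simp add: coef_def)
  next
    case False
    then have "f y = f x" if "y \<in> cs k x" for y using f[OF x] cs_mono[of n k x] that by auto
    then have "coset_integral k (\<lambda>y. f y * u y) x = coset_integral k (\<lambda>y. f x * u y) x"
      unfolding coset_integral_def L2_inner_def
        by (intro Bochner_Integration.integral_cong) (auto simp: indicator_def)
    then show ?thesis by (simp add: coset_integral_def L2_inner_scale_left)
  qed
  then show ?thesis unfolding level_op_def
    by (simp only: suminf_mult[OF sums_summable[OF level_op_sums[OF admissible u x]]])
qed

section \<open>Boundedness and compactness\<close>

definition level_operator :: "(nat \<Rightarrow> real) \<Rightarrow> 'a operator" where
  "level_operator \<rho> = \<lparr>op_dom = L2 M, op_app = level_op \<rho>\<rparr>"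

lemma level_operator_bounded:
  assumes "admissible \<rho>"
  shows "bounded_operator M (level_operator \<rho>)"
  unfolding bounded_operator_def
proof (intro conjI)
  show "linear_operator M (level_operator \<rho>)"
    unfolding linear_operator_def level_operator_def
    using assms by (auto simp: L2_zero L2_add L2_scale level_op_L2 level_op_cong_AE level_op_add level_op_scale space_M intro!: ae_eq_space)
  show "\<exists>C. \<forall>f\<in>L2 M. L2_norm M (op_app (level_operator \<rho>) f) \<le> C * L2_norm M f"
    using level_op_norm[OF assms] by (auto simp: level_operator_def)
qed (simp add: level_operator_def)

text \<open>There are countably many cosets, so a diagonal subsequence makes the integrals over all
  of them converge. Tannery's theorem carries this over to the series at each point, and the uniform
  bound \<open>coef_norm \<rho> * C\<close> turns pointwise convergence into convergence in norm.
  The limit is constructed as a function; no limit of the \<open>f k\<close> themselves is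
  taken.\<close>

lemma level_operator_compact:
  assumes admissible: "admissible \<rho>"
  shows "compact_operator M (level_operator \<rho>)"
  unfolding compact_operator_def
proof (intro conjI allI impI level_operator_bounded[OF admissible], elim conjE exE)
  fix f :: "nat \<Rightarrow> 'a \<Rightarrow> complex" and C
  assume f: "\<forall>k. f k \<in> L2 M" and C: "\<forall>k. L2_norm M (f k) \<le> C"
  have fL: "f k \<in> L2 M" and fC: "L2_norm M (f k) \<le> C" for k using f C by auto
  have cnt: "countable (\<Union>k. cs k ` carrier G)" using countable_cosets by (simp add: cosets_def)
  have bd: "cmod (coset_integral k (f j) x) \<le> C" if "x \<in> carrier G" for j k x
    using coset_integral_bound[OF fL that, of k j] fC[of j] by simp
  have "cmod (L2_inner M (f j) (indicator A)) \<le> C" if A: "A \<in> (\<Union>k. cs k ` carrier G)" for j A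
  proof -
    obtain k x where "A = cs k x" "x \<in> carrier G" using A by blast
    then show ?thesis using bd[of x k j] by (simp add: coset_integral_def)
  qed
  from function_convergent_subsequence[where S="\<Union>k. cs k ` carrier G"
      and f="\<lambda>j A. L2_inner M (f j) (indicator A)", OF cnt this]
  obtain sub where sub: "strict_mono (sub::nat\<Rightarrow>nat)"
    and lim: "\<And>A. A \<in> (\<Union>k. cs k ` carrier G) \<Longrightarrow> \<exists>l. (\<lambda>j. L2_inner M (f (sub j)) (indicator A)) \<longlonglongrightarrow> l"
    by blast
  define l where "l k x = lim (\<lambda>j. coset_integral k (f (sub j)) x)" for k x
  have l: "(\<lambda>j. coset_integral k (f (sub j)) x) \<longlonglongrightarrow> l k x" if "x \<in> carrier G" for k x
  proof -
    have "cs k x \<in> (\<Union>k. cs k ` carrier G)" using that by blast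
    then have "convergent (\<lambda>j. coset_integral k (f (sub j)) x)"
      using lim unfolding convergent_def coset_integral_def by blast
    then show ?thesis unfolding l_def by (simp only: convergent_LIMSEQ_iff)
  qed
  define g where "g x = (\<Sum>k. complex_of_real (coef \<rho> k) * l k x)" for x
  have lC: "cmod (l k x) \<le> C" if "x \<in> carrier G" for k x
    by (rule tendsto_upperbound[OF tendsto_norm[OF l[OF that]]]) (auto simp: bd that)
  have Ks: "(\<lambda>j. level_op \<rho> (f (sub j)) x) \<longlonglongrightarrow> g x" if x: "x \<in> carrier G" for x
    unfolding level_op_def g_def
  proof (rule conjunct2[OF conjunct2[OF tannerys_theorem[of _ _ sequentially "\<lambda>k. \<bar>coef \<rho> k\<bar> * C"]]])
    show "((\<lambda>j. complex_of_real (coef \<rho> k) * coset_integral k (f (sub j)) x) \<longlongrightarrow> complex_of_real (coef \<rho> k) * l k x) sequentially" for k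
      by (intro tendsto_mult tendsto_const l x)
    show "\<forall>\<^sub>F (k, j) in sequentially \<times>\<^sub>F sequentially.
        cmod (complex_of_real (coef \<rho> k) * coset_integral k (f (sub j)) x) \<le> \<bar>coef \<rho> k\<bar> * C"
      by (intro always_eventually) (auto simp: norm_mult bd x intro!: mult_left_mono)
    show "summable (\<lambda>k. \<bar>coef \<rho> k\<bar> * C)"
      by (rule summable_mult2[OF coef_summable[OF admissible]])
  qed simp
  have KC: "cmod (level_op \<rho> (f j) x) \<le> coef_norm \<rho> * C" if "x \<in> carrier G" for j x
    using level_op_bound[OF admissible fL that, of j] mult_left_mono[OF fC coef_norm_nonneg[OF admissible], of j] by simp
  have gC: "cmod (g x) \<le> coef_norm \<rho> * C" if "x \<in> carrier G" for x
    by (rule tendsto_upperbound[OF tendsto_norm[OF Ks[OF that]]]) (auto simp: KC that)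
  have "g \<in> borel_measurable M"
    by (rule borel_measurable_LIMSEQ_metric[where f="\<lambda>j. level_op \<rho> (f (sub j))", OF level_op_measurable[OF admissible fL]]) (simp add: Ks space_M)
  then have g: "g \<in> L2 M"
    by (rule L2_bounded[where C="coef_norm \<rho> * C"]) (simp add: gC space_M)
  have "(\<lambda>j. L2_norm M (\<lambda>x. level_op \<rho> (f (sub j)) x - g x)) \<longlonglongrightarrow> 0"
  proof (rule L2_norm_tendsto_0[where w="\<lambda>x. (coef_norm \<rho> * C + coef_norm \<rho> * C)\<^sup>2"])
    fix j x assume "x \<in> space M"
    then have "cmod (level_op \<rho> (f (sub j)) x - g x) \<le> coef_norm \<rho> * C + coef_norm \<rho> * C"
      by (intro norm_triangle_le_diff add_mono KC gC) (simp_all add: space_M)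
    from power_mono[OF this norm_ge_zero]
    show "(cmod (level_op \<rho> (f (sub j)) x - g x))\<^sup>2 \<le> (coef_norm \<rho> * C + coef_norm \<rho> * C)\<^sup>2" .
  qed (simp_all add: level_op_L2 admissible fL g Ks space_M)
  then show "\<exists>sub g. strict_mono sub \<and> g \<in> L2 M \<and>
      (\<lambda>k. L2_norm M (\<lambda>x. op_app (level_operator \<rho>) (f (sub k)) x - g x)) \<longlonglongrightarrow> 0"
    using sub g by (auto simp: level_operator_def)
qed

section \<open>The Dirac operator\<close>

text \<open>These are the eigenvalues of the inverse of D, the reciprocals of the \<lambda>_k; in
  particular \<open>eigval 0\<close> is 1.\<close>

definition eigval :: "nat \<Rightarrow> real" where
  "eigval k = mass k ^ k"

lemma eigval_pos: "0 < eigval k"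
  by (simp add: eigval_def mass_pos)

lemma eigval_decseq: "decseq eigval"
proof (rule decseq_SucI)
  fix k
  have "mass (Suc k) ^ Suc k \<le> mass (Suc k) ^ k"
    using mass_pos[of "Suc k"] mass_le_1[of "Suc k"] by (intro power_decreasing) auto
  also have "\<dots> \<le> mass k ^ k"
    using mass_pos[of "Suc k"] decseqD[OF mass_decseq, of k "Suc k"] by (intro power_mono) auto
  finally show "eigval (Suc k) \<le> eigval k" by (simp add: eigval_def)
qed

text \<open>The k-th term is m_k^(k s - 1). As soon as k s >= 2 it is at most m_k, because m_k <= 1,
  and hence at most 2^-k.\<close>

lemma admissible_eigval_powr:
  assumes "0 < s"
  shows "admissible (\<lambda>k. eigval k powr s)"
  unfolding admissible_def
proof (rule summable_comparison_test_ev)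
  show "summable (\<lambda>k. (1/2)^k :: real)" by (rule summable_geometric) simp
  have "norm (\<bar>eigval k powr s\<bar> / mass k) \<le> (1/2)^k" if k: "k \<ge> nat \<lceil>2 / s\<rceil>" for k
  proof -
    have "2 / s \<le> real k" using k by linarith
    then have ks: "2 \<le> real k * s" using assms by (simp add: pos_divide_le_eq)
    have "\<bar>eigval k powr s\<bar> / mass k = mass k powr (real k * s - 1)"
      using mass_pos[of k] by (simp add: eigval_def powr_realpow[symmetric] powr_powr powr_diff)
    also have "\<dots> \<le> mass k powr 1" using ks mass_pos[of k] mass_le_1[of k]
      by (intro powr_mono') auto
    also have "\<dots> \<le> (1/2)^k" using mass_pos[of k] mass_le_half_power[of k] by simp
    finally show ?thesis using mass_pos[of k] by simp
  qed
  then show "\<forall>\<^sub>F k in sequentially. norm (\<bar>eigval k powr s\<bar> / mass k) \<le> (1/2)^k"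
    unfolding eventually_sequentially by blast
qed

lemma admissible_eigval: "admissible eigval"
proof -
  have "(\<lambda>k. eigval k powr 1) = eigval" using eigval_pos by (simp add: fun_eq_iff less_imp_le)
  then show ?thesis using admissible_eigval_powr[of 1] by simp
qed

lemma admissible_bounded_mult:
  assumes "admissible \<rho>" "\<And>k. \<bar>\<sigma> k\<bar> \<le> c * \<bar>\<rho> k\<bar>"
  shows "admissible \<sigma>"
  unfolding admissible_def
proof (rule summable_comparison_test[OF _ summable_mult[OF assms(1)[unfolded admissible_def], of c]], intro exI allI impI)
  fix k
  show "norm (\<bar>\<sigma> k\<bar> / mass k) \<le> c * (\<bar>\<rho> k\<bar> / mass k)"
    using assms(2)[of k] mass_pos[of k] by (simp add: divide_right_mono)
qed

lemma admissible_finite: "(\<And>k. n < k \<Longrightarrow> \<sigma> k = 0) \<Longrightarrow> admissible \<sigma>"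
  unfolding admissible_def by (rule summable_finite[of "{..n}"]) auto

text \<open>Pairing with a vector of level n multiplies by \<open>eigval n\<close>, which is not
  zero. This makes the inverse single-valued up to almost everywhere equality.\<close>

lemma level_op_eigval_inj:
  assumes "u \<in> L2 M" "v \<in> L2 M" "ae_eq M (level_op eigval u) (level_op eigval v)"
  shows "ae_eq M u v"
proof (rule level_vector_total_eq[OF assms(1,2)])
  fix n e assume e: "level_vector n e"
  have "L2_inner M (level_op eigval u) e = L2_inner M (level_op eigval v) e"
    using assms e by (intro L2_inner_cong_AE ae_eq_refl level_op_L2 admissible_eigval) (auto simp: level_vector_L2)
  then show "L2_inner M u e = L2_inner M v e"
    using e assms eigval_pos[of n] by (simp add: level_op_inner_level_vector[OF admissible_eigval])
qed

section \<open>The inverse operator, its domain and self-adjointness\<close>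

text \<open>The inverse of \<open>level_op eigval\<close>. Its domain is the range of that operator,
  saturated under almost everywhere equality as \<open>linear_operator\<close> demands; the choice
  is only one of a representative.\<close>

definition dirac :: "'a operator" where
  "dirac = \<lparr>op_dom = {f\<in>L2 M. \<exists>g\<in>L2 M. ae_eq M f (level_op eigval g)},
          op_app = (\<lambda>f. SOME g. g \<in> L2 M \<and> ae_eq M f (level_op eigval g))\<rparr>"

lemma dirac_dom_L2: "f \<in> op_dom dirac \<Longrightarrow> f \<in> L2 M"
  by (simp add: dirac_def)

lemma dirac_app:
  assumes "f \<in> op_dom dirac"
  shows "op_app dirac f \<in> L2 M" "ae_eq M f (level_op eigval (op_app dirac f))"
proof -
  have "\<exists>g. g \<in> L2 M \<and> ae_eq M f (level_op eigval g)" using assms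
    by (auto simp: dirac_def)
  from someI_ex[OF this] show "op_app dirac f \<in> L2 M" "ae_eq M f (level_op eigval (op_app dirac f))"
    by (simp_all add: dirac_def)
qed

text \<open>With \<open>dirac_app\<close> it hides the choice: claims about \<open>dirac\<close>
  become claims about its inverse.\<close>

lemma dirac_eqI:
  assumes "f \<in> L2 M" "g \<in> L2 M" "ae_eq M f (level_op eigval g)"
  shows "f \<in> op_dom dirac" "ae_eq M (op_app dirac f) g"
proof -
  show f: "f \<in> op_dom dirac" using assms by (auto simp: dirac_def)
  show "ae_eq M (op_app dirac f) g"
    by (rule level_op_eigval_inj[OF dirac_app(1)[OF f] assms(2) ae_eq_trans[OF ae_eq_sym[OF dirac_app(2)[OF f]] assms(3)]])
qed

lemma dirac_linear: "linear_operator M dirac"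
  unfolding linear_operator_def
proof (intro conjI ballI impI allI)
  show "op_dom dirac \<subseteq> L2 M" using dirac_dom_L2 by blast
  have "ae_eq M (\<lambda>x. 0) (level_op eigval (\<lambda>x. 0))"
    by (rule ae_eq_space) (use level_op_scale[OF admissible_eigval L2_zero, of _ 0] in \<open>simp add: space_M\<close>)
  then show "(\<lambda>x. 0) \<in> op_dom dirac" by (rule dirac_eqI[OF L2_zero L2_zero])
  fix f assume f: "f \<in> op_dom dirac"
  note fL = dirac_dom_L2[OF f] and Df = dirac_app[OF f]
  show "op_app dirac f \<in> L2 M" by (rule Df)
  {
    fix g assume g: "g \<in> L2 M" "ae_eq M f g"
    have "ae_eq M g (level_op eigval (op_app dirac f))" using ae_eq_trans[OF ae_eq_sym[OF g(2)] Df(2)] .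
    from dirac_eqI[OF g(1) Df(1) this]
    show "g \<in> op_dom dirac" "ae_eq M (op_app dirac f) (op_app dirac g)" by (simp_all only: ae_eq_sym)
  }
  {
    fix g assume g: "g \<in> op_dom dirac"
    note gL = dirac_dom_L2[OF g] and Dg = dirac_app[OF g]
    have "ae_eq M (\<lambda>x. level_op eigval (op_app dirac f) x + level_op eigval (op_app dirac g) x) (level_op eigval (\<lambda>x. op_app dirac f x + op_app dirac g x))"
      by (rule ae_eq_space) (simp add: level_op_add admissible_eigval Df Dg space_M)
    from dirac_eqI[OF L2_add[OF fL gL] L2_add[OF Df(1) Dg(1)] ae_eq_trans[OF ae_eq_add[OF Df(2) Dg(2)] this]]
    show "(\<lambda>x. f x + g x) \<in> op_dom dirac"
      "ae_eq M (op_app dirac (\<lambda>x. f x + g x)) (\<lambda>x. op_app dirac f x + op_app dirac g x)" .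
  }
  {
    fix c
    have "ae_eq M (\<lambda>x. c * level_op eigval (op_app dirac f) x) (level_op eigval (\<lambda>x. c * op_app dirac f x))"
      by (rule ae_eq_space) (simp add: level_op_scale admissible_eigval Df space_M)
    from dirac_eqI[OF L2_scale[OF fL] L2_scale[OF Df(1)] ae_eq_trans[OF ae_eq_mult[OF Df(2)] this]]
    show "(\<lambda>x. c * f x) \<in> op_dom dirac"
      "ae_eq M (op_app dirac (\<lambda>x. c * f x)) (\<lambda>x. c * op_app dirac f x)" .
  }
qed

text \<open>A coset indicator of level n has no component above level n. Hence
  \<open>level_op q\<close>, with \<open>q\<close> inverting \<open>eigval\<close> up to n and 0
  beyond, produces a preimage.\<close>

lemma one_cs_dom:
  assumes x: "x \<in> carrier G"
  shows "one_cs n x \<in> op_dom dirac"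
proof -
  define q where "q k = (if k \<le> n then 1 / eigval k else 0)" for k
  have q: "admissible q" by (rule admissible_finite[of n]) (simp add: q_def)
  have "ae_eq M (one_cs n x) (level_op eigval (level_op q (one_cs n x)))"
  proof (rule level_vector_total_eq)
    fix j e assume e: "level_vector j e"
    have "j > n \<Longrightarrow> L2_inner M (one_cs n x) e = 0"
      using e x L2_inner_commute[of M "one_cs n x" e] by (simp add: level_vector_def coset_integral_def)
    then show "L2_inner M (one_cs n x) e = L2_inner M (level_op eigval (level_op q (one_cs n x))) e"
      using eigval_pos[of j] x by (cases "j \<le> n")
        (simp_all add: level_op_inner_level_vector[OF admissible_eigval e] level_op_inner_level_vector[OF q e] level_op_L2[OF q] one_cs_L2 q_def)
  qed (use x in \<open>simp_all add: one_cs_L2 level_op_L2 q admissible_eigval\<close>)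
  then show ?thesis using x by (intro dirac_eqI(1)[OF _ level_op_L2[OF q]]) (auto simp: one_cs_L2)
qed

lemma dirac_dense: "densely_defined M dirac"
  unfolding densely_defined_def
proof (intro ballI allI impI)
  fix f and \<epsilon> :: real assume "f \<in> L2 M" "0 < \<epsilon>"
  then show "\<exists>g\<in>op_dom dirac. L2_norm M (\<lambda>x. f x - g x) < \<epsilon>"
  proof (rule L2_dense[OF sets_M_cosets cosets_subset Int_stable_cosets, rotated 5])
    show "indicator (space M) \<in> op_dom dirac" using one_cs_dom[of \<one> 0]
      by (simp add: cs_0 space_M)
    fix A assume "A \<in> cosets"
    then show "(indicator A :: 'a \<Rightarrow> complex) \<in> op_dom dirac"
      unfolding cosets_def
    proof (elim insertE UN_E imageE)
      assume "A = {}"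
      moreover have "(\<lambda>x. 0) \<in> op_dom dirac" using dirac_linear
        by (simp add: linear_operator_def)
      ultimately show ?thesis by (simp add: indicator_def[abs_def])
    qed (simp add: one_cs_dom)
  qed (use dirac_linear in \<open>auto simp: linear_operator_def\<close>)
qed

lemma level_op_eigval_dom: "u \<in> L2 M \<Longrightarrow> level_op eigval u \<in> op_dom dirac" "u \<in> L2 M \<Longrightarrow> ae_eq M (op_app dirac (level_op eigval u)) u"
  using dirac_eqI[of "level_op eigval u" u] by (simp_all add: level_op_L2 admissible_eigval ae_eq_refl)

text \<open>The inverse of an injective symmetric operator R defined everywhere is self-adjoint. For
  the harder direction the test vectors f = R u, with arbitrary u, turn the adjoint relation into
  <u, g> = <u, R h>, so g = R h.\<close>

lemma dirac_self_adjoint: "self_adjoint M dirac"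
  unfolding self_adjoint_def
proof (intro conjI ballI dirac_linear dirac_dense)
  fix g h assume g: "g \<in> L2 M" and h: "h \<in> L2 M"
  show "(g \<in> op_dom dirac \<and> ae_eq M (op_app dirac g) h) \<longleftrightarrow>
      (\<forall>f\<in>op_dom dirac. L2_inner M (op_app dirac f) g = L2_inner M f h)" (is "?lhs \<longleftrightarrow> ?rhs")
  proof
    assume ?lhs
    then have Dg: "g \<in> op_dom dirac" "ae_eq M (op_app dirac g) h" by auto
    have "ae_eq M (level_op eigval (op_app dirac g)) (level_op eigval h)"
      by (rule ae_eq_space, rule level_op_cong_AE[OF Dg(2) dirac_app(1)[OF Dg(1)] h]) (simp add: space_M)
    then have gh: "ae_eq M g (level_op eigval h)" using dirac_app[OF Dg(1)] ae_eq_trans by blast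
    show ?rhs
    proof
      fix f assume f: "f \<in> op_dom dirac"
      note Df = dirac_app[OF f]
      have "L2_inner M (op_app dirac f) g = L2_inner M (op_app dirac f) (level_op eigval h)"
        by (rule L2_inner_cong_AE[OF ae_eq_refl gh]) (simp_all add: Df g h level_op_L2 admissible_eigval)
      also have "\<dots> = L2_inner M (level_op eigval (op_app dirac f)) h"
        using level_op_sym[OF admissible_eigval Df(1) h] by simp
      also have "\<dots> = L2_inner M f h"
        by (rule L2_inner_cong_AE[OF ae_eq_sym[OF Df(2)] ae_eq_refl])
           (simp_all add: Df f h level_op_L2 admissible_eigval dirac_dom_L2)
      finally show "L2_inner M (op_app dirac f) g = L2_inner M f h" .
    qed
  next
    assume rhs: ?rhs
    have "L2_inner M u g = L2_inner M u (level_op eigval h)" if u: "u \<in> L2 M" for u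
    proof -
      have "L2_inner M u g = L2_inner M (op_app dirac (level_op eigval u)) g"
        by (rule L2_inner_cong_AE[OF ae_eq_sym[OF level_op_eigval_dom(2)[OF u]] ae_eq_refl])
           (simp_all add: level_op_eigval_dom(1)[OF u] dirac_app(1) u g)
      also have "\<dots> = L2_inner M (level_op eigval u) h" using rhs level_op_eigval_dom[OF u] by blast
      finally show ?thesis using level_op_sym[OF admissible_eigval u h] by simp
    qed
    then have "L2_inner M g u = L2_inner M (level_op eigval h) u" if "u \<in> L2 M" for u
      using that L2_inner_commute[of M g u] L2_inner_commute[of M "level_op eigval h" u] by simp
    then have "ae_eq M g (level_op eigval h)"
      using g h by (intro level_vector_total_eq) (simp_all add: level_op_L2 admissible_eigval level_vector_L2)
    then show ?lhs using dirac_eqI[OF g h] by blast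
  qed
qed

text \<open>The point 0 is in the resolvent set by construction, with
  \<open>level_operator eigval\<close> itself as the resolvent.\<close>

lemma dirac_compact_resolvent: "compact_resolvent M dirac"
proof -
  have "is_resolvent M dirac 0 (level_operator eigval)"
    unfolding is_resolvent_def
  proof (intro conjI ballI level_operator_bounded admissible_eigval)
    fix g assume "g \<in> L2 M"
    then show "op_app (level_operator eigval) g \<in> op_dom dirac"
      "ae_eq M (\<lambda>x. op_app dirac (op_app (level_operator eigval) g) x - 0 * op_app (level_operator eigval) g x) g"
      using level_op_eigval_dom by (simp_all add: level_operator_def)
  next
    fix f assume "f \<in> op_dom dirac"
    then show "ae_eq M (op_app (level_operator eigval) (\<lambda>x. op_app dirac f x - 0 * f x)) f"
      using dirac_app(2) by (simp add: level_operator_def ae_eq_sym)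
  qed
  then show ?thesis using level_operator_compact[OF admissible_eigval]
    unfolding compact_resolvent_def by blast
qed


text \<open>Write \<open>R\<close> for the inverse of \<open>D\<close>. The operator \<open>D - S\<close>, where \<open>S\<close> has the eigenvalues \<open>s\<close> below,
  is constant on levels up to \<open>n\<close> and hence commutes with \<open>f\<close>, so \<open>[D, f] = [S, f]\<close> with \<open>S\<close> bounded.
  To avoid domain questions this is checked on \<open>g = R u\<close>, with \<open>z\<close> the eigenvalues of \<open>(D - S)\<^sup>-\<^sup>1\<close>.\<close>

lemma dirac_bounded_commutator:
  assumes fm: "f \<in> borel_measurable M" and fb: "\<And>x. x \<in> carrier G \<Longrightarrow> cmod (f x) \<le> C" and C: "0 \<le> C"
    and f: "\<And>x y. x \<in> carrier G \<Longrightarrow> y \<in> cs n x \<Longrightarrow> f y = f x"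
  shows "bounded_commutator M dirac f"
proof -
  \<comment> \<open>With \<lambda>_k = 1 / \<open>eigval k\<close>, this is \<lambda>_k -
    \<lambda>_n on the levels up to n, so D - S has the eigenvalue \<lambda>_n on all of them and
    agrees with D above.\<close>
  define s where "s k = (if k \<le> n then 1 / eigval k - 1 / eigval n else 0)" for k
  define z where "z k = (if k \<le> n then eigval n else eigval k)" for k
  have s: "admissible s" by (rule admissible_finite[of n]) (simp add: s_def)
  have z: "admissible z"
    by (rule admissible_bounded_mult[OF admissible_eigval, of _ 1]) (use eigval_pos decseqD[OF eigval_decseq] in \<open>simp add: z_def less_imp_le\<close>)
  \<comment> \<open>Both equations are 1 / z k = 1 / \<open>eigval k\<close> - s k with denominators
    cleared. The second will yield g = (D - S)^-1 v, the first D (f g) = w.\<close>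
  have rsz: "eigval k + eigval k * s k * z k = z k" "z k - z k * s k * eigval k = eigval k" for k
    using eigval_pos[of k] eigval_pos[of n] by (simp_all add: s_def z_def field_simps)
  have zc: "z k = z n" if "k \<le> n" for k using that by (simp add: z_def)
  have mult_f: "(\<lambda>x. f x * u x) \<in> L2 M" if "u \<in> L2 M" for u
    using that fm fb by (rule L2_mult_bounded) (simp add: space_M)
  have norm_f: "L2_norm M (\<lambda>x. f x * u x) \<le> C * L2_norm M u" if u: "u \<in> L2 M" for u
  proof -
    have "(LINT x|M. (cmod (f x * u x))\<^sup>2) \<le> (LINT x|M. (cmod (complex_of_real C * u x))\<^sup>2)"
    proof (rule integral_mono)
      show "integrable M (\<lambda>x. (cmod (f x * u x))\<^sup>2)" using mult_f[OF u]
        by (rule L2_integrable_sq)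
      show "integrable M (\<lambda>x. (cmod (complex_of_real C * u x))\<^sup>2)" using L2_scale[OF u]
        by (rule L2_integrable_sq)
      fix x assume "x \<in> space M"
      then show "(cmod (f x * u x))\<^sup>2 \<le> (cmod (complex_of_real C * u x))\<^sup>2"
        using fb C by (intro power_mono) (auto simp: norm_mult space_M intro: mult_right_mono)
    qed
    then have "L2_norm M (\<lambda>x. f x * u x) \<le> L2_norm M (\<lambda>x. complex_of_real C * u x)"
      by (simp add: L2_norm_def)
    then show ?thesis using C unfolding L2_norm_scale by simp
  qed
  \<comment> \<open>The commutator [S, f], spelled as a sum so that the rules for sums and scalar
    multiples apply.\<close>
  define Bf where "Bf u x = level_op s (\<lambda>y. f y * u y) x + - 1 * (f x * level_op s u x)" for u x
  have BL: "Bf u \<in> L2 M" if "u \<in> L2 M" for u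
    unfolding Bf_def[abs_def] using that by (intro L2_add L2_scale level_op_L2 s mult_f)
  have main: "(\<lambda>x. f x * g x) \<in> op_dom dirac \<and>
      ae_eq M (op_app dirac (\<lambda>x. f x * g x)) (\<lambda>x. f x * op_app dirac g x + Bf g x)"
    if g: "g \<in> op_dom dirac" for g
  proof -
    define u where "u = op_app dirac g"
    have u: "u \<in> L2 M" and gu: "ae_eq M g (level_op eigval u)" using dirac_app[OF g]
      by (simp_all add: u_def)
    note gL = dirac_dom_L2[OF g]
    \<comment> \<open>This is (D - S) g.\<close>
    define v where "v x = u x - level_op s g x" for x
    have v: "v \<in> L2 M" unfolding v_def[abs_def] by (intro L2_diff u level_op_L2 s gL)
    define a where "a x = f x * v x" for x
    have a: "a \<in> L2 M" unfolding a_def[abs_def] by (rule mult_f[OF v])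
    have gv: "ae_eq M g (level_op z v)"
    proof (rule level_vector_total_eq[OF gL level_op_L2[OF z v]])
      fix j e assume e: "level_vector j e"
      have ge: "L2_inner M g e = eigval j * L2_inner M u e"
        using L2_inner_cong_AE[OF gu ae_eq_refl gL level_op_L2[OF admissible_eigval u], of e] level_op_inner_level_vector[OF admissible_eigval e u] level_vector_L2[OF e]
        by simp
      have "L2_inner M (level_op z v) e = z j * (L2_inner M u e - s j * (eigval j * L2_inner M u e))"
        unfolding level_op_inner_level_vector[OF z e v] unfolding v_def[abs_def]
        by (simp add: L2_inner_diff_left[OF u level_op_L2[OF s gL] level_vector_L2[OF e]] level_op_inner_level_vector[OF s e gL] ge)
      also have "\<dots> = complex_of_real (z j - z j * s j * eigval j) * L2_inner M u e"
        by (simp add: algebra_simps)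
      finally show "L2_inner M g e = L2_inner M (level_op z v) e" by (simp only: rsz ge)
    qed
    \<comment> \<open>Here locality enters: \<open>z\<close> is constant up to level n, so f passes
      through (D - S)^-1 and f g = (D - S)^-1 (f v).\<close>
    have "ae_eq M (\<lambda>x. f x * level_op z v x) (level_op z a)"
      unfolding a_def[abs_def]
      by (rule ae_eq_space, rule level_op_local[OF v z f zc, symmetric]) (simp_all add: space_M)
    from ae_eq_trans[OF ae_eq_mult[OF gv] this] have fg: "ae_eq M (\<lambda>x. f x * g x) (level_op z a)" .
    note fgL = mult_f[OF gL]
    \<comment> \<open>The expected value f (D g) + [S, f] g of D (f g). The contribution - f (S g)
      of the commutator turns f (D g) into f v, which leaves f v + S (f g).\<close>
    define w where "w x = f x * u x + Bf g x" for x
    have w: "w \<in> L2 M" unfolding w_def[abs_def] by (intro L2_add mult_f u BL gL)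
    have wa: "w = (\<lambda>x. a x + level_op s (\<lambda>y. f y * g y) x)"
      by (auto simp: w_def Bf_def a_def v_def fun_eq_iff algebra_simps)
    have "ae_eq M (\<lambda>x. f x * g x) (level_op eigval w)"
    proof (rule level_vector_total_eq[OF fgL level_op_L2[OF admissible_eigval w]])
      fix j e assume e: "level_vector j e"
      have fge: "L2_inner M (\<lambda>x. f x * g x) e = z j * L2_inner M a e"
        using L2_inner_cong_AE[OF fg ae_eq_refl fgL level_op_L2[OF z a], of e] level_op_inner_level_vector[OF z e a] level_vector_L2[OF e]
        by simp
      have "L2_inner M (level_op eigval w) e = eigval j * (L2_inner M a e + s j * (z j * L2_inner M a e))"
        unfolding level_op_inner_level_vector[OF admissible_eigval e w] unfolding wa
        by (simp add: L2_inner_add_left[OF a level_op_L2[OF s fgL] level_vector_L2[OF e]] level_op_inner_level_vector[OF s e fgL] fge)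
      also have "\<dots> = complex_of_real (eigval j + eigval j * s j * z j) * L2_inner M a e"
        by (simp add: algebra_simps)
      finally show "L2_inner M (\<lambda>x. f x * g x) e = L2_inner M (level_op eigval w) e"
        by (simp only: rsz fge)
    qed
    from dirac_eqI[OF fgL w this] show ?thesis by (simp add: w_def[abs_def] u_def)
  qed
  have "bounded_operator M \<lparr>op_dom = L2 M, op_app = Bf\<rparr>"
    unfolding bounded_operator_def
  proof (intro conjI)
    have cong: "ae_eq M (Bf u) (Bf v)" if uv: "u \<in> L2 M" "v \<in> L2 M" "ae_eq M u v" for u v
    proof (rule ae_eq_space)
      fix x assume "x \<in> space M"
      then show "Bf u x = Bf v x"
        using level_op_cong_AE[OF ae_eq_mult[OF uv(3)] mult_f[OF uv(1)] mult_f[OF uv(2)], of x s]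
          level_op_cong_AE[OF uv(3,1,2), of x s] by (simp add: Bf_def space_M)
    qed
    have add: "ae_eq M (Bf (\<lambda>x. u x + v x)) (\<lambda>x. Bf u x + Bf v x)" if uv: "u \<in> L2 M" "v \<in> L2 M" for u v
    proof (rule ae_eq_space)
      fix x assume "x \<in> space M"
      then show "Bf (\<lambda>x. u x + v x) x = Bf u x + Bf v x"
        using level_op_add[OF s mult_f[OF uv(1)] mult_f[OF uv(2)], of x] level_op_add[OF s uv, of x]
        by (simp add: Bf_def space_M distrib_left)
    qed
    have scale: "ae_eq M (Bf (\<lambda>x. c * u x)) (\<lambda>x. c * Bf u x)" if u: "u \<in> L2 M" for u c
    proof (rule ae_eq_space)
      fix x assume "x \<in> space M"
      then show "Bf (\<lambda>x. c * u x) x = c * Bf u x"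
        using level_op_scale[OF s mult_f[OF u], of x c] level_op_scale[OF s u, of x c]
        by (simp add: Bf_def space_M algebra_simps)
    qed
    show "linear_operator M \<lparr>op_dom = L2 M, op_app = Bf\<rparr>"
      unfolding linear_operator_def operator.simps
    proof (intro conjI ballI allI impI)
      fix u v c assume u: "u \<in> L2 M" and v: "v \<in> L2 M"
      show "Bf u \<in> L2 M" by (rule BL[OF u])
      show "v \<in> L2 M" if "ae_eq M u v" by (rule v)
      show "ae_eq M (Bf u) (Bf v)" if "ae_eq M u v" by (rule cong[OF u v that])
      show "(\<lambda>x. u x + v x) \<in> L2 M" by (rule L2_add[OF u v])
      show "ae_eq M (Bf (\<lambda>x. u x + v x)) (\<lambda>x. Bf u x + Bf v x)" by (rule add[OF u v])
      show "(\<lambda>x. c * u x) \<in> L2 M" by (rule L2_scale[OF u])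
      show "ae_eq M (Bf (\<lambda>x. c * u x)) (\<lambda>x. c * Bf u x)" by (rule scale[OF u])
    qed (simp_all add: L2_zero BL L2_scale scale)
    show "\<exists>C. \<forall>u\<in>L2 M. L2_norm M (op_app \<lparr>op_dom = L2 M, op_app = Bf\<rparr> u) \<le> C * L2_norm M u"
    proof (intro exI ballI)
      fix u assume u: "u \<in> L2 M"
      have "L2_norm M (Bf u) \<le> L2_norm M (level_op s (\<lambda>y. f y * u y)) + L2_norm M (\<lambda>x. - 1 * (f x * level_op s u x))"
        unfolding Bf_def[abs_def] by (intro L2_norm_triangle L2_scale mult_f level_op_L2 s u)
      also have "L2_norm M (\<lambda>x. - 1 * (f x * level_op s u x)) = L2_norm M (\<lambda>x. f x * level_op s u x)"
        unfolding L2_norm_scale by simp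
      also have "\<dots> \<le> C * (coef_norm s * L2_norm M u)"
        using norm_f[OF level_op_L2[OF s u]] mult_left_mono[OF level_op_norm[OF s u] C] by simp
      also have "L2_norm M (level_op s (\<lambda>y. f y * u y)) \<le> coef_norm s * (C * L2_norm M u)"
        using level_op_norm[OF s mult_f[OF u]] mult_left_mono[OF norm_f[OF u] coef_norm_nonneg[OF s]] by simp
      finally show "L2_norm M (op_app \<lparr>op_dom = L2 M, op_app = Bf\<rparr> u) \<le> (2 * (coef_norm s * C)) * L2_norm M u"
        by (simp add: algebra_simps)
    qed
  qed simp
  moreover have "ae_eq M (Bf g) (\<lambda>x. op_app dirac (\<lambda>y. f y * g y) x - f x * op_app dirac g x)"
    if "g \<in> op_dom dirac" for g
    using main[OF that] unfolding ae_eq_def by (auto elim: eventually_mono)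
  ultimately show ?thesis
    unfolding bounded_commutator_def using main
    by (intro conjI ballI exI[of _ "\<lparr>op_dom = L2 M, op_app = Bf\<rparr>"]) simp_all
qed

section \<open>Equivariance\<close>

lemma right_regular_L2:
  assumes "x \<in> carrier G" "u \<in> L2 M"
  shows "right_regular G x u \<in> L2 M"
proof -
  note tr = right_translation_preserves[OF assms(1)]
  have "integrable M (\<lambda>y. (cmod (u (y \<otimes> x)))\<^sup>2)"
    using integrable_distr[OF tr(1), of "\<lambda>y. (cmod (u y))\<^sup>2"] assms(2)
      by (simp add: tr(2) L2_def)
  moreover have "(\<lambda>y. u (y \<otimes> x)) \<in> borel_measurable M"
    using measurable_compose[OF tr(1) L2_measurable[OF assms(2)]] .
  ultimately show ?thesis by (simp add: L2_def right_regular_def)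
qed

lemma right_regular_ae_eq:
  assumes "x \<in> carrier G" "ae_eq M u v"
  shows "ae_eq M (right_regular G x u) (right_regular G x v)"
proof -
  note tr = right_translation_preserves[OF assms(1)]
  have "AE y in distr M M (\<lambda>y. y \<otimes> x). u y = v y" unfolding tr(2) using assms(2)
    by (simp only: ae_eq_def)
  from AE_distrD[OF tr(1) this] show ?thesis by (simp add: ae_eq_def right_regular_def)
qed

text \<open>Right translation by x preserves the measure and carries the coset of y to the coset of
  y x at each level, so every term of the series is equivariant.\<close>

lemma level_op_right_regular:
  assumes x: "x \<in> carrier G" and y: "y \<in> carrier G" and u: "u \<in> L2 M"
  shows "level_op \<rho> (right_regular G x u) y = right_regular G x (level_op \<rho> u) y"
proof -
  note tr = right_translation_preserves[OF x]
  note [measurable] = L2_measurable[OF u]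
  have "coset_integral k (right_regular G x u) y = coset_integral k u (y \<otimes> x)" for k
  proof -
    have "coset_integral k u (y \<otimes> x) = (LINT z|distr M M (\<lambda>z. z \<otimes> x). u z * cnj (one_cs k (y \<otimes> x) z))"
      unfolding coset_integral_def L2_inner_def tr(2) ..
    also have "\<dots> = (LINT z|M. u (z \<otimes> x) * cnj (one_cs k (y \<otimes> x) (z \<otimes> x)))"
      using x y by (intro integral_distr[OF tr(1)]) (auto intro!: borel_measurable_times L2_measurable[OF one_cs_L2] measurable_compose[OF _ measurable_cnj])
    also have "\<dots> = coset_integral k (right_regular G x u) y"
      unfolding coset_integral_def L2_inner_def right_regular_def using x y
      by (intro Bochner_Integration.integral_cong) (auto simp: space_M right_translate_cs indicator_def)
    finally show ?thesis ..
  qed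
  then show ?thesis by (simp add: level_op_def right_regular_def)
qed

lemma dirac_equivariant: "equivariant_operator G M dirac"
  unfolding equivariant_operator_def
proof (intro ballI)
  fix x f assume x: "x \<in> carrier G" and f: "f \<in> op_dom dirac"
  note Df = dirac_app[OF f]
  have "ae_eq M (right_regular G x (level_op eigval (op_app dirac f))) (level_op eigval (right_regular G x (op_app dirac f)))"
    by (rule ae_eq_space) (simp add: level_op_right_regular x Df space_M)
  from dirac_eqI[OF right_regular_L2[OF x dirac_dom_L2[OF f]] right_regular_L2[OF x Df(1)]
      ae_eq_trans[OF right_regular_ae_eq[OF x Df(2)] this]]
  show "right_regular G x f \<in> op_dom dirac \<and>
      ae_eq M (op_app dirac (right_regular G x f)) (right_regular G x (op_app dirac f))" by blast
qed

section \<open>Negative powers and summability\<close>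

text \<open>An eigenvector f for t may a priori mix levels. For a vector e of level n one gets <f,
  e> = \<open>eigval n\<close> * t * <f, e>, so the pairing vanishes unless t = 1 /
  \<open>eigval n\<close>. Comparing pairings is therefore enough; for t = 0 all of them
  vanish.\<close>

lemma level_operator_abs_neg_power:
  assumes "0 < s"
  shows "is_abs_neg_power M dirac s (level_operator (\<lambda>k. eigval k powr s))"
  unfolding is_abs_neg_power_def
proof (intro conjI level_operator_bounded admissible_eigval_powr assms allI ballI impI)
  fix t f assume f: "f \<in> op_dom dirac" and tf: "ae_eq M (op_app dirac f) (\<lambda>x. complex_of_real t * f x)"
  note fL = dirac_dom_L2[OF f] and Df = dirac_app[OF f]
  define c where "c = (if t = 0 then 0 else \<bar>t\<bar> powr (- s))"
  have "ae_eq M (level_op (\<lambda>k. eigval k powr s) f) (\<lambda>x. complex_of_real c * f x)"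
  proof (rule level_vector_total_eq)
    fix n e assume e: "level_vector n e"
    have "L2_inner M f e = L2_inner M (level_op eigval (op_app dirac f)) e"
      using fL Df level_vector_L2[OF e]
        by (intro L2_inner_cong_AE ae_eq_refl) (auto simp: level_op_L2 admissible_eigval)
    also have "\<dots> = eigval n * L2_inner M (op_app dirac f) e"
      by (rule level_op_inner_level_vector[OF admissible_eigval e Df(1)])
    also have "L2_inner M (op_app dirac f) e = t * L2_inner M f e"
      unfolding L2_inner_scale_left[symmetric]
      using fL Df level_vector_L2[OF e] tf by (intro L2_inner_cong_AE ae_eq_refl) (auto simp: L2_scale)
    finally have *: "L2_inner M f e = eigval n * (t * L2_inner M f e)" .
    have "eigval n powr s * L2_inner M f e = c * L2_inner M f e"
    proof (cases "L2_inner M f e = 0")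
      case False
      with * have "complex_of_real (eigval n * t) = 1" by simp
      then have "eigval n * t = 1" by (simp only: of_real_eq_1_iff)
      then have "t = 1 / eigval n" using eigval_pos[of n] by (simp add: field_simps)
      then have "c = eigval n powr s" using eigval_pos[of n] by (simp add: c_def powr_minus powr_divide)
      then show ?thesis by simp
    qed simp
    then show "L2_inner M (level_op (\<lambda>k. eigval k powr s) f) e = L2_inner M (\<lambda>x. complex_of_real c * f x) e"
      by (simp add: level_op_inner_level_vector[OF admissible_eigval_powr[OF assms] e fL] L2_inner_scale_left)
  qed (simp_all add: fL level_op_L2 admissible_eigval_powr assms L2_scale)
  then show "ae_eq M (op_app (level_operator (\<lambda>k. eigval k powr s)) f)
      (\<lambda>x. complex_of_real (if t = 0 then 0 else \<bar>t\<bar> powr (- s)) * f x)"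
    by (simp add: level_operator_def c_def)
qed

text \<open>By Bessel's inequality the trace is finite with respect to every orthonormal basis, so no basis
  of eigenvectors has to be constructed.\<close>

lemma level_operator_finite_trace:
  assumes admissible: "admissible \<rho>" and dec: "decseq \<rho>"
  shows "finite_trace M (level_operator \<rho>)"
proof -
  obtain E where E: "orthonormal_basis M E" using orthonormal_basis_exists by blast
  then have EL: "E \<subseteq> L2 M" and on: "\<And>e e'. e \<in> E \<Longrightarrow> e' \<in> E \<Longrightarrow> L2_inner M e e' = (if e = e' then 1 else 0)"
    by (auto simp: orthonormal_basis_def)
  \<comment> \<open>Monotonicity of \<rho> makes the Abel coefficients nonnegative, so the diagonal
    entries are nonnegative and it suffices to bound their finite sums.\<close>
  have coef: "0 \<le> coef \<rho> k" for k
    using decseqD[OF dec, of k "Suc k"] mass_pos[of k] by (simp add: coef_def)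
  define q where "q k e = (\<Sum>C\<in>cs k ` carrier G. (cmod (L2_inner M (indicator C) e))\<^sup>2)" for k e
  have q: "L2_inner M (coset_integral k e) e = complex_of_real (q k e)" if "e \<in> L2 M" for k e
    unfolding coset_integral_inner[OF that that] q_def of_real_sum
    by (rule sum.cong[OF refl])
       (simp only: complex_norm_square L2_inner_commute[of M e "indicator _"] mult.commute)
  define t where "t e = (\<Sum>k. coef \<rho> k * q k e)" for e
  have t: "(\<lambda>k. coef \<rho> k * q k e) sums t e" "L2_inner M (level_op \<rho> e) e = complex_of_real (t e)" if e: "e \<in> L2 M" for e
  proof -
    have *: "(\<lambda>k. complex_of_real (coef \<rho> k * q k e)) sums L2_inner M (level_op \<rho> e) e"
      using level_op_inner_sums[OF admissible e e] by (simp add: q e)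
    then have "summable (\<lambda>k. coef \<rho> k * q k e)"
      using sums_summable summable_of_real_iff by blast
    then show 1: "(\<lambda>k. coef \<rho> k * q k e) sums t e" unfolding t_def by (rule summable_sums)
    show "L2_inner M (level_op \<rho> e) e = complex_of_real (t e)"
      using sums_unique2[OF * sums_of_real[OF 1]] .
  qed
  have "t summable_on E"
  proof (rule nonneg_bdd_above_summable_on)
    fix e assume "e \<in> E"
    then have e: "e \<in> L2 M" using EL by blast
    have "0 \<le> coef \<rho> k * q k e" for k using coef by (simp add: q_def sum_nonneg)
    from sums_le[OF this sums_zero t(1)[OF e]] show "0 \<le> t e" .
  next
    have "sum t X \<le> coef_norm \<rho>" if X: "X \<subseteq> E" "finite X" for X
    proof (rule sums_le)
      show "(\<lambda>k. \<Sum>e\<in>X. coef \<rho> k * q k e) sums sum t X"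
        using t(1) X EL by (intro sums_sum) auto
      show "(\<lambda>k. \<bar>coef \<rho> k\<bar>) sums coef_norm \<rho>" unfolding coef_norm_def
        by (rule summable_sums[OF coef_summable[OF admissible]])
      fix k
      \<comment> \<open>Each coset contributes at most the squared norm \<open>mass k\<close> of its
        indicator, by Bessel, and there are 1 / \<open>mass k\<close> cosets. The bound 1 is the
        trace of \<open>mass k\<close> times a projection of rank 1 / \<open>mass k\<close>.\<close>
      have "(\<Sum>e\<in>X. q k e) = (\<Sum>C\<in>cs k ` carrier G. \<Sum>e\<in>X. (cmod (L2_inner M (indicator C) e))\<^sup>2)"
        unfolding q_def by (rule sum.swap)
      also have "\<dots> \<le> (\<Sum>C\<in>cs k ` carrier G. mass k)"
      proof (rule sum_mono)
        fix C assume "C \<in> cs k ` carrier G"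
        then obtain x where x: "x \<in> carrier G" "C = cs k x" by blast
        show "(\<Sum>e\<in>X. (cmod (L2_inner M (indicator C) e))\<^sup>2) \<le> mass k"
          using bessel[OF X(2) _ _ one_cs_L2[OF x(1), of k]] X(1) EL on L2_norm_one_cs[OF x(1), of k] x(2)
          by (simp add: subset_iff)
      qed
      also have "\<dots> = 1" using card_cosets[of k] by simp
      finally show "(\<Sum>e\<in>X. coef \<rho> k * q k e) \<le> \<bar>coef \<rho> k\<bar>"
        unfolding sum_distrib_left[symmetric] using coef[of k] by (simp add: mult_left_le)
    qed
    then show "bdd_above (sum t ` {X. X \<subseteq> E \<and> finite X})"
      by (intro bdd_aboveI2[of _ _ "coef_norm \<rho>"]) auto
  qed
  then have "(\<lambda>e. complex_of_real (t e)) summable_on E" by (rule summable_on_of_real)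
  then have "(\<lambda>e. L2_inner M (level_op \<rho> e) e) summable_on E"
    by (rule summable_on_cong[THEN iffD1, rotated]) (use t(2) EL in auto)
  then show ?thesis unfolding finite_trace_def using E by (auto simp: level_operator_def)
qed

lemma dirac_summable:
  assumes "0 < s"
  shows "summable_operator M dirac s"
proof -
  have "decseq (\<lambda>k. eigval k powr s)"
    using decseqD[OF eigval_decseq] eigval_pos assms
      by (intro decseq_SucI powr_mono2) (auto simp: less_imp_le)
  then show ?thesis
    unfolding summable_operator_def
    using level_operator_abs_neg_power[OF assms] level_operator_finite_trace[OF admissible_eigval_powr[OF assms]] by blast
qed

end

section \<open>Smooth functions are locally constant\<close>

text \<open>With \<open>a h = U h - 1\<close> the hypothesis on squares is \<open>U h\<^sup>2 - 1 = 2 (U h - 1) + (U h - 1)\<^sup>2\<close>, so a bound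
  for \<open>U - 1\<close> on a subgroup improves itself by the factor \<open>3/4\<close>.\<close>

lemma small_square_closed_zero:
  fixes a :: "'h \<Rightarrow> nat \<Rightarrow> nat \<Rightarrow> complex"
  assumes sq: "\<And>h. h \<in> S \<Longrightarrow> sq h \<in> S"
    and a_sq: "\<And>h i j. h \<in> S \<Longrightarrow> i < n \<Longrightarrow> j < n \<Longrightarrow>
      a (sq h) i j = 2 * a h i j + (\<Sum>k<n. a h i k * a h k j)"
    and small: "\<And>h i j. h \<in> S \<Longrightarrow> i < n \<Longrightarrow> j < n \<Longrightarrow> cmod (a h i j) \<le> \<epsilon>" "real n * \<epsilon> \<le> 1/2" "0 \<le> \<epsilon>"
    and h: "h \<in> S" "i < n" "j < n"
  shows "a h i j = 0"
proof -
  have "cmod (a h i j) \<le> \<epsilon> * (3/4)^p" if "h \<in> S" "i < n" "j < n" for p h i j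
    using that
  proof (induction p arbitrary: h i j)
    case 0
    then show ?case using small(1) by simp
  next
    case (Suc p)
    define d where "d = \<epsilon> * (3/4)^p"
    have d: "0 \<le> d" using small(3) by (simp add: d_def)
    have IH: "cmod (a h i j) \<le> d" if "h \<in> S" "i < n" "j < n" for h i j
      using Suc.IH[OF that] by (simp add: d_def)
    \<comment> \<open>One factor of each product is bounded by the fixed \<epsilon>, the other by
      the current bound d, so the quadratic part is at most d / 2. Solving for 2 a(h) gives (d + d /
      2) / 2, the factor 3/4. The current bound is needed at \<open>sq h\<close>, so the induction
      treats all of \<open>S\<close> at once.\<close>
    have "cmod (\<Sum>k<n. a h i k * a h k j) \<le> (\<Sum>k<n. \<epsilon> * d)"
      using Suc.prems d by (intro sum_norm_le) (auto simp: norm_mult intro!: mult_mono small IH)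
    also have "\<dots> = real n * \<epsilon> * d" by simp
    also have "\<dots> \<le> 1/2 * d" using small(2) d by (rule mult_right_mono)
    finally have s: "cmod (\<Sum>k<n. a h i k * a h k j) \<le> d / 2" by simp
    have "2 * a h i j = a (sq h) i j - (\<Sum>k<n. a h i k * a h k j)"
      using a_sq[OF Suc.prems] by simp
    from arg_cong[OF this, of cmod]
    have "2 * cmod (a h i j) = cmod (a (sq h) i j - (\<Sum>k<n. a h i k * a h k j))"
      by (simp add: norm_mult)
    also have "\<dots> \<le> d + d / 2"
      by (rule norm_triangle_le_diff[OF add_mono[OF IH[OF sq[OF Suc.prems(1)] Suc.prems(2,3)] s]])
    finally show ?case by (simp add: d_def)
  qed
  moreover have "(\<lambda>p. \<epsilon> * (3/4)^p) \<longlonglongrightarrow> \<epsilon> * 0"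
    by (intro tendsto_mult tendsto_const LIMSEQ_power_zero) simp
  ultimately have "cmod (a h i j) \<le> 0"
    using h by (intro tendsto_lowerbound[of "\<lambda>p. \<epsilon> * (3/4)^p"]) auto
  then show ?thesis by simp
qed

text \<open>\<open>unitary_rep\<close> does not postulate the value at the identity. That value is
  an idempotent with a left inverse, its adjoint, hence the identity matrix.\<close>

lemma unitary_rep_one:
  assumes "group G" "unitary_rep G T n U"
  shows "U \<one>\<^bsub>G\<^esub> = 1\<^sub>m n"
proof -
  interpret group G by fact
  let ?A = "U \<one>\<^bsub>G\<^esub>"
  have A: "?A \<in> carrier_mat n n" "mat_adjoint ?A * ?A = 1\<^sub>m n" "?A * ?A = ?A"
    using assms(2) by (auto simp: unitary_rep_def dest!: bspec[OF _ one_closed])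
  have adj: "mat_adjoint ?A \<in> carrier_mat n n" using A(1) by (auto simp: mat_adjoint_def)
  have "1\<^sub>m n = mat_adjoint ?A * (?A * ?A)" using A by simp
  also have "\<dots> = (mat_adjoint ?A * ?A) * ?A" using assoc_mult_mat[OF adj A(1) A(1)] by simp
  finally show ?thesis using A by simp
qed

context vilenkin_haar
begin

lemma unitary_rep_trivial:
  assumes U: "unitary_rep G T n U"
  shows "\<forall>\<^sub>F N in sequentially. \<forall>h\<in>H N. U h = 1\<^sub>m n"
proof -
  \<comment> \<open>Chosen for n * \<epsilon> <= 1/2, the threshold of
    \<open>small_square_closed_zero\<close>; the + 1 keeps it positive for n = 0.\<close>
  define \<epsilon> :: real where "\<epsilon> = 1 / (2 * (real n + 1))"
  have \<epsilon>: "0 < \<epsilon>" "real n * \<epsilon> \<le> 1/2"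
    by (auto simp: \<epsilon>_def field_simps)
  have Umat: "U x \<in> carrier_mat n n" if "x \<in> carrier G" for x
    using U that by (simp add: unitary_rep_def)
  have Umult: "U (x \<otimes> y) = U x * U y" if "x \<in> carrier G" "y \<in> carrier G" for x y
    using U that by (simp add: unitary_rep_def)
  have U1: "U \<one> = 1\<^sub>m n" using unitary_rep_one[OF is_group U] .
  define a where "a h i j = U h $$ (i, j) - 1\<^sub>m n $$ (i, j)" for h i j
  have "\<forall>\<^sub>F N in sequentially. \<forall>h\<in>H N. cmod (a h i j) < \<epsilon>" if ij: "i < n" "j < n" for i j
  proof -
    have "continuous_map T euclidean (\<lambda>x. U x $$ (i, j))" using U ij
      by (simp add: unitary_rep_def)
    then have "openin T {x \<in> topspace T. U x $$ (i, j) \<in> ball (1\<^sub>m n $$ (i, j)) \<epsilon>}"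
      by (rule openin_continuous_map_preimage) simp
    note 1 = this
    have "\<one> \<in> {x \<in> topspace T. U x $$ (i, j) \<in> ball (1\<^sub>m n $$ (i, j)) \<epsilon>}"
      using \<epsilon> by (simp add: topspace_T U1)
    from H_basis[OF 1 this]
    obtain N where N: "H N \<subseteq> {x \<in> topspace T. U x $$ (i, j) \<in> ball (1\<^sub>m n $$ (i, j)) \<epsilon>}" ..
    have "cmod (a h i j) < \<epsilon>" if "N \<le> N'" "h \<in> H N'" for N' h
    proof -
      have "h \<in> H N" using H_mono[OF that(1)] that(2) by blast
      then show ?thesis using N by (auto simp: a_def dist_norm norm_minus_commute)
    qed
    then show ?thesis unfolding eventually_sequentially by blast
  qed
  then have "\<forall>\<^sub>F N in sequentially. \<forall>i\<in>{..<n}. \<forall>j\<in>{..<n}. \<forall>h\<in>H N. cmod (a h i j) < \<epsilon>"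
    by (intro eventually_ball_finite ballI) auto
  then show ?thesis
  proof eventually_elim
    case (elim N)
    have hG: "h \<in> carrier G" if "h \<in> H N" for h using that H_carrier by blast
    have "a h i j = 0" if h: "h \<in> H N" "i < n" "j < n" for h i j
    proof (rule small_square_closed_zero[where sq="\<lambda>h. h \<otimes> h" and S="H N" and n=n and a=a and \<epsilon>=\<epsilon>])
      fix h i j assume h: "h \<in> H N" and ij: "i < n" "j < n"
      have "U (h \<otimes> h) $$ (i, j) = (\<Sum>k<n. U h $$ (i, k) * U h $$ (k, j))"
        using Umult[OF hG[OF h] hG[OF h]] Umat[OF hG[OF h]] ij
        by (simp add: scalar_prod_def atLeast0LessThan)
      \<comment> \<open>Both factors are written as identity plus \<open>a\<close>; the Kronecker
        deltas leave two copies of \<open>a h i j\<close>, the linear term of the squaring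
        relation.\<close>
      also have "\<dots> = (\<Sum>k<n. a h i k * a h k j + (if k = j then a h i k else 0) + (if k = i then a h k j else 0)
          + (if k = i then 1\<^sub>m n $$ (k, j) else 0))"
        using ij by (intro sum.cong) (auto simp: a_def algebra_simps)
      also have "\<dots> = (\<Sum>k<n. a h i k * a h k j) + a h i j + a h i j + 1\<^sub>m n $$ (i, j)"
        using ij by (simp add: sum.distrib)
      finally show "a (h \<otimes> h) i j = 2 * a h i j + (\<Sum>k<n. a h i k * a h k j)"
        by (simp add: a_def[of "h \<otimes> h"])
    qed (use elim \<epsilon> h subgroup.m_closed[OF H_subgroup] in \<open>auto intro: less_imp_le\<close>)
    then have "U h = 1\<^sub>m n" if "h \<in> H N" for h
      using that Umat[OF hG[OF that]] by (intro eq_matI) (auto simp: a_def)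
    then show ?case by blast
  qed
qed

text \<open>Generators reduce to \<open>unitary_rep_trivial\<close> by U (x h) = U x U h. The claim
  is made for all large N, so that sums and products, which need a common N, follow by combining
  filters.\<close>

lemma coefficient_locally_constant:
  assumes "f \<in> coefficient_algebra G T"
  shows "\<forall>\<^sub>F N in sequentially. \<forall>x\<in>carrier G. \<forall>y\<in>cs N x. f y = f x"
  using assms
proof induction
  case (entry n U i j)
  then have U: "unitary_rep G T n U" by (simp add: irreducible_unitary_rep_def)
  from unitary_rep_trivial[OF U] show ?case
  proof eventually_elim
    case (elim N)
    show ?case
    proof (intro ballI)
      fix x y assume x: "x \<in> carrier G" and "y \<in> cs N x"
      then obtain h where h: "h \<in> H N" "y = x \<otimes> h" by (auto simp: cs_def l_coset_def)
      have "h \<in> carrier G" using h H_carrier by blast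
      then have "U y = U x * 1\<^sub>m n" "U x \<in> carrier_mat n n"
        using elim h x U by (simp_all add: unitary_rep_def)
      then show "U y $$ (i, j) = U x $$ (i, j)" by simp
    qed
  qed
next
  case (add f g)
  from add.IH show ?case by eventually_elim simp
next
  case (scale f c)
  from scale.IH show ?case by eventually_elim simp
next
  case (mult f g)
  from mult.IH show ?case by eventually_elim simp
next
  case (star f)
  from star.IH show ?case by eventually_elim simp
qed

text \<open>Evaluating the tensor decomposition at x = 1 writes \<open>f\<close> as a linear
  combination of the finitely many \<open>h i\<close>, which share a level N.\<close>

lemma smooth_locally_constant:
  assumes "f \<in> smooth_algebra G T"
  obtains N where "\<And>x y. x \<in> carrier G \<Longrightarrow> y \<in> cs N x \<Longrightarrow> f y = f x"
proof -
  obtain n :: nat and g h where h: "\<And>i. i < n \<Longrightarrow> h i \<in> coefficient_algebra G T"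
    and f: "\<And>x y. x \<in> carrier G \<Longrightarrow> y \<in> carrier G \<Longrightarrow> f (x \<otimes> y) = (\<Sum>i<n. g i x * h i y)"
    using assms unfolding smooth_algebra_def by blast
  have f1: "f y = (\<Sum>i<n. g i \<one> * h i y)" if "y \<in> carrier G" for y
    using f[OF one_closed that] that by simp
  have "\<forall>\<^sub>F N in sequentially. \<forall>i\<in>{..<n}. \<forall>x\<in>carrier G. \<forall>y\<in>cs N x. h i y = h i x"
    by (rule eventually_ball_finite) (simp_all add: coefficient_locally_constant h)
  from eventually_happens'[OF sequentially_bot this]
  obtain N where N: "\<forall>i\<in>{..<n}. \<forall>x\<in>carrier G. \<forall>y\<in>cs N x. h i y = h i x" ..
  show ?thesis
  proof
    fix x y assume x: "x \<in> carrier G" and y: "y \<in> cs N x"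
    show "f y = f x" using N x y by (simp add: f1 cs_carrier[OF y x])
  qed
qed

lemma locally_constant_bounded:
  fixes f :: "'a \<Rightarrow> complex"
  assumes "\<And>x y. x \<in> carrier G \<Longrightarrow> y \<in> cs N x \<Longrightarrow> f y = f x"
  obtains C where "0 \<le> C" "\<And>x. x \<in> carrier G \<Longrightarrow> cmod (f x) \<le> C"
proof -
  have "f ` carrier G \<subseteq> (\<lambda>A. f (SOME y. y \<in> A)) ` cs N ` carrier G"
  proof
    fix z assume "z \<in> f ` carrier G"
    then obtain x where x: "x \<in> carrier G" "z = f x" by blast
    have "(SOME y. y \<in> cs N x) \<in> cs N x" using cs_self[OF x(1)] by (rule someI)
    then have "z = f (SOME y. y \<in> cs N x)" using assms x by simp
    then show "z \<in> (\<lambda>A. f (SOME y. y \<in> A)) ` cs N ` carrier G" using x by blast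
  qed
  then have "finite (f ` carrier G)" using finite_cosets finite_subset by blast
  then obtain C where "0 < C" "\<forall>z\<in>f ` carrier G. cmod z \<le> C"
    using finite_imp_bounded bounded_pos by metis
  then show ?thesis by (intro that[of C]) auto
qed

lemma dirac_spectral_triple: "equivariant_spectral_triple G T M dirac"
  unfolding equivariant_spectral_triple_def
proof (intro conjI ballI dirac_self_adjoint dirac_compact_resolvent dirac_equivariant)
  fix f assume "f \<in> smooth_algebra G T"
  then obtain N where N: "\<And>x y. x \<in> carrier G \<Longrightarrow> y \<in> cs N x \<Longrightarrow> f y = f x"
    by (rule smooth_locally_constant) blast
  obtain C where C: "0 \<le> C" "\<And>x. x \<in> carrier G \<Longrightarrow> cmod (f x) \<le> C"
    by (rule locally_constant_bounded[where f=f, OF N]) blast+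
  show "bounded_commutator M dirac f"
    by (rule dirac_bounded_commutator[OF locally_constant_measurable[OF N] C(2,1) N])
qed

end

lemma Inf_ereal_greaterThan_0: "Inf (ereal ` {s. 0 < s}) = 0"
proof (rule Inf_eqI)
  fix y assume y: "\<And>x. x \<in> ereal ` {s. 0 < s} \<Longrightarrow> y \<le> x"
  show "y \<le> 0"
  proof (rule ccontr)
    assume "\<not> y \<le> 0"
    then obtain z where "0 < ereal z" "ereal z < y" using ereal_dense2[of 0 y] not_le by blast
    then show False using y[of "ereal z"] by force
  qed
qed auto

theorem theorem3p8:
  fixes G :: "('a, 'b) monoid_scheme" and T :: "'a topology" and \<mu> :: "'a measure"
  assumes "compact_vilenkin_group G T"
    and "haar_probability G T \<mu>"
  shows "spectral_dimension G T \<mu> = 0"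
proof -
  obtain H where "vilenkin_sequence G T H"
    using assms(1) by (auto simp: compact_vilenkin_group_def)
  then interpret vilenkin_haar G T H \<mu>
    using assms by unfold_locales (auto simp: compact_vilenkin_group_def)
  \<comment> \<open>The operator \<open>dirac\<close> does not depend on s: the same one is
    s-summable for every positive s.\<close>
  have "{s. 0 < s \<and> (\<exists>D. equivariant_spectral_triple G T \<mu> D \<and> summable_operator \<mu> D s)} = {s. 0 < s}"
    using dirac_spectral_triple dirac_summable by blast
  then show ?thesis by (simp add: spectral_dimension_def Inf_ereal_greaterThan_0)
qed

end
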